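(* Let $q$ and $k$ be nonnegative integers and let $G$ be an almost balanced bipartite graph with $|V(G)|=2n-1$ and $\delta(G)\ge k\ge q+1$. (i) If $n\ge 3k+4$, $0\le\alpha\le1$ (with $\alpha$ real), and $\Theta(G,\alpha)>\Omega(\alpha)$, then $G$ is $(q,q)$-traceable unless $G\subseteq Z_{n+q-k-1,\,k-q}$. (ii) If $n\ge 4k(k+1)$, and if either $\rho(G)\ge\rho(Z^0_{n+q-k-1,\,k-q})$ or $\mu(G)\ge\mu(Z^0_{n+q-k-1,\,k-q})$, then $G$ is $(q,q)$-traceable unless $G\in\{Z_{n+q-k-1,\,k-q},\,Z^0_{n+q-k-1,\,k-q}\}$.
   Context: Graphs are finite, simple and undirected; equality and the subgraph relation $\subseteq$ between graphs are up to isomorphism. A bipartite graph $G=[U,V]$ is almost balanced if $|U|-|V|\in\{1,-1\}$. $\delta(G)$ is the minimum degree. For real $\alpha\ge0$, $\Theta(G,\alpha)$ is the largest eigenvalue of $A(G)+\alpha D(G)$, where $A(G)$ is the adjacency matrix and $D(G)$ the diagonal degree matrix; $\rho(G)=\Theta(G,0)$ and $\mu(G)=\Theta(G,1)$. Define $$\Omega(\alpha)=\alpha\left(2n+q-k-2+\frac{(k+1)(k+1-q)}{n}\right)+(1-\alpha)\sqrt{n(n+q-k-2)+(k+1)(k+1-q)}.$$ An almost balanced bipartite graph $G=[U,V]$ is $(q,q)$-traceable if for every $S\subset V(G)$ with $|S\cap U|=|S\cap V|=q$, the graph $G-S$ contains a spanning path. For integers $n>k\ge 0$, $a\ge k+1$,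 $b\ge1$, let $(X,Y)$ be the bipartition of $K_{n,a+b}$ with $|X|=n$, $|Y|=a+b$, let $X_1\subset X$ with $|X_1|=n-k$ and $Y_1\subset Y$ with $|Y_1|=b$. Then $Z_{a,b}$ (depending also on $n,k$) is the graph obtained from $K_{n,a+b}$ by deleting all edges between $X_1$ and $Y_1$, and $Z^0_{a,b}=Z_{a,b}-e$, where $e=uv$ is an edge of $Z_{a,b}$ with $u\in Y\setminus Y_1$ (so $d(u)=n$) and $v\in X_1$ (so $d(v)=a$). *)

theory Defs
  imports
    "Jordan_Normal_Form.Spectral_Radius"
    "Graph_Theory.Graph_Theory"
begin

text \<open>
  Simple undirected graphs are the symmetric loop-free pair digraphs of \<^locale>\<open>pair_graph\<close>: an
  undirected edge $uv$ is the pair of arcs $(u,v)$, $(v,u)$, so the degree of a vertex is its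
  \<^const>\<open>out_degree\<close>.
\<close>

definition min_degree :: "'a pair_pre_digraph \<Rightarrow> nat" where
  "min_degree G = Min (out_degree (with_proj G) ` pverts G)"

definition delete_edges :: "'a pair_pre_digraph \<Rightarrow> 'a set \<Rightarrow> 'a set \<Rightarrow> 'a pair_pre_digraph" where
  "delete_edges G A B = \<lparr> pverts = pverts G, parcs = parcs G - (A \<times> B \<union> B \<times> A) \<rparr>"

text \<open>The relation $G \subseteq H$ up to isomorphism.\<close>
definition embeds :: "'a pair_pre_digraph \<Rightarrow> 'b pair_pre_digraph \<Rightarrow> bool" where
  "embeds G H \<longleftrightarrow> (\<exists>G'. subgraph G' (with_proj H) \<and> digraph_iso (with_proj G) G')"

definition has_spanning_path :: "('a, 'b) pre_digraph \<Rightarrow> bool" where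
  "has_spanning_path G \<longleftrightarrow> (\<exists>p. vpath p G \<and> set p = verts G)"

subsection \<open>Almost balanced bipartite graphs\<close>

text \<open>
  A disconnected graph may have several bipartitions; as in the notation $G = [U,V]$ the
  bipartition is part of the data, and traceability refers to it.
\<close>

definition bipartite_graph :: "'a pair_pre_digraph \<Rightarrow> 'a set \<Rightarrow> 'a set \<Rightarrow> bool" where
  "bipartite_graph G U V \<longleftrightarrow>
     pair_graph G \<and> pverts G = U \<union> V \<and> U \<inter> V = {} \<and> parcs G \<subseteq> U \<times> V \<union> V \<times> U"

definition almost_balanced_bipartite :: "'a pair_pre_digraph \<Rightarrow> 'a set \<Rightarrow> 'a set \<Rightarrow> bool" where
  "almost_balanced_bipartite G U V \<longleftrightarrow>
     bipartite_graph G U V \<and> int (card U) - int (card V) \<in> {1, -1}"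

definition qq_traceable :: "nat \<Rightarrow> 'a pair_pre_digraph \<Rightarrow> 'a set \<Rightarrow> 'a set \<Rightarrow> bool" where
  "qq_traceable q G U V \<longleftrightarrow>
     (\<forall>S. S \<subseteq> pverts G \<and> card (S \<inter> U) = q \<and> card (S \<inter> V) = q \<longrightarrow>
        has_spanning_path (with_proj G \<restriction> (pverts G - S)))"

subsection \<open>The eigenvalue parameters\<close>

text \<open>
  Matrices are indexed by natural numbers, so the matrices of a graph are taken with respect to a
  labelling \<open>f\<close> of its vertices. The eigenvalues do not depend on the labelling.
\<close>

definition vertex_labelling :: "'a pair_pre_digraph \<Rightarrow> (nat \<Rightarrow> 'a) \<Rightarrow> bool" where
  "vertex_labelling G f \<longleftrightarrow> bij_betw f {..<card (pverts G)} (pverts G)"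

definition adjacency_matrix :: "'a pair_pre_digraph \<Rightarrow> (nat \<Rightarrow> 'a) \<Rightarrow> real mat" where
  "adjacency_matrix G f = mat (card (pverts G)) (card (pverts G))
     (\<lambda>(i, j). if (f i, f j) \<in> parcs G then 1 else 0)"

definition degree_matrix :: "'a pair_pre_digraph \<Rightarrow> (nat \<Rightarrow> 'a) \<Rightarrow> real mat" where
  "degree_matrix G f = mat (card (pverts G)) (card (pverts G))
     (\<lambda>(i, j). if i = j then real (out_degree (with_proj G) (f i)) else 0)"

definition Theta :: "'a pair_pre_digraph \<Rightarrow> real \<Rightarrow> real" where
  "Theta G \<alpha> = Max {l. \<exists>f. vertex_labelling G f \<and>
     eigenvalue (adjacency_matrix G f + \<alpha> \<cdot>\<^sub>m degree_matrix G f) l}"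

definition rho :: "'a pair_pre_digraph \<Rightarrow> real" where
  "rho G = Theta G 0"

definition mu :: "'a pair_pre_digraph \<Rightarrow> real" where
  "mu G = Theta G 1"

lemma eigenvalue_relabel:
  assumes f: "vertex_labelling G f" and g: "vertex_labelling G g"
    and ev: "eigenvalue (adjacency_matrix G f + \<alpha> \<cdot>\<^sub>m degree_matrix G f) l"
  shows "eigenvalue (adjacency_matrix G g + \<alpha> \<cdot>\<^sub>m degree_matrix G g) l"
proof -
  define N where "N = card (pverts G)"
  define M where "M = (\<lambda>h. adjacency_matrix G h + \<alpha> \<cdot>\<^sub>m degree_matrix G h)"
  define c :: "'a \<Rightarrow> 'a \<Rightarrow> real" where "c = (\<lambda>x y. (if (x, y) \<in> parcs G then 1 else 0) +
    (if x = y then \<alpha> * real (out_degree (with_proj G) x) else 0))"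
  define s where "s = (\<lambda>i. the_inv_into {..<N} f (g i))"
  have fb: "bij_betw f {..<N} (pverts G)" and gb: "bij_betw g {..<N} (pverts G)"
    using f g by (auto simp: vertex_labelling_def N_def)
  have sb: "bij_betw s {..<N} {..<N}"
    using bij_betw_trans[OF gb bij_betw_the_inv_into[OF fb]] by (simp add: s_def comp_def)
  have fs: "f (s i) = g i" if "i < N" for i
    using f_the_inv_into_f_bij_betw[OF fb] gb that by (auto simp: s_def bij_betw_def)
  have dimM: "dim_row (M h) = N" "dim_col (M h) = N" for h
    by (auto simp: M_def adjacency_matrix_def degree_matrix_def N_def)
  have Mc: "M h $$ (i, j) = c (h i) (h j)"
    if "bij_betw h {..<N} (pverts G)" "i < N" "j < N" for h i j
    using that by (auto simp: M_def adjacency_matrix_def degree_matrix_def N_def c_def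
        bij_betw_def inj_on_eq_iff)
  obtain v where v: "v \<in> carrier_vec N" "v \<noteq> 0\<^sub>v N" "M f *\<^sub>v v = l \<cdot>\<^sub>v v"
    using ev dimM(1)[of f]
    unfolding eigenvalue_def eigenvector_def by (auto simp: M_def)
  have veq: "(\<Sum>j<N. c (f i) (f j) * v $ j) = l * v $ i" if "i < N" for i
  proof -
    have "(M f *\<^sub>v v) $ i = (\<Sum>j<N. c (f i) (f j) * v $ j)"
      using that v(1) Mc[OF fb] dimM by (auto simp: scalar_prod_def lessThan_atLeast0 intro!: sum.cong)
    then show ?thesis using that v by auto
  qed
  define w where "w = vec N (\<lambda>i. v $ (s i))"
  have weq: "(M g *\<^sub>v w) $ i = (l \<cdot>\<^sub>v w) $ i" if "i < N" for i
  proof -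
    have si: "s i < N" using sb that by (auto simp: bij_betw_def)
    have "(M g *\<^sub>v w) $ i = (\<Sum>j<N. c (g i) (g j) * v $ (s j))"
      using that Mc[OF gb] dimM by (auto simp: w_def scalar_prod_def lessThan_atLeast0 intro!: sum.cong)
    also have "\<dots> = (\<Sum>j<N. c (f (s i)) (f (s j)) * v $ (s j))"
      using that by (intro sum.cong) (auto simp: fs)
    also have "\<dots> = (\<Sum>j<N. c (f (s i)) (f j) * v $ j)"
      by (rule sum.reindex_bij_betw[OF sb])
    also have "\<dots> = l * v $ (s i)" by (rule veq[OF si])
    finally show ?thesis using that by (simp add: w_def)
  qed
  obtain i where i: "i < N" "v $ i \<noteq> 0" using v(1,2) by (metis carrier_vecD eq_vecI index_zero_vec(1,2))
  then obtain j where "j < N" "s j = i"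
    using bij_betw_imp_surj_on[OF sb] by (metis imageE lessThan_iff)
  then have "w \<noteq> 0\<^sub>v N" using i by (auto simp: w_def dest: arg_cong[where f = "\<lambda>x. x $ j"])
  moreover have "M g *\<^sub>v w = l \<cdot>\<^sub>v w"
    using weq by (intro eq_vecI) (auto simp: dimM w_def)
  ultimately have "eigenvector (M g) w l" by (auto simp: eigenvector_def dimM w_def)
  then show ?thesis by (auto simp: eigenvalue_def M_def)
qed

lemma Theta_eq_Max_spectrum:
  assumes "vertex_labelling G f"
  shows "Theta G \<alpha> = Max (spectrum (adjacency_matrix G f + \<alpha> \<cdot>\<^sub>m degree_matrix G f))"
  unfolding Theta_def spectrum_def
  by (rule arg_cong[where f = Max]) (use assms eigenvalue_relabel in blast)

definition Omega :: "nat \<Rightarrow> nat \<Rightarrow> nat \<Rightarrow> real \<Rightarrow> real" where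
  "Omega n q k \<alpha> =
     \<alpha> * (2 * real n + real q - real k - 2 + (real k + 1) * (real k + 1 - real q) / real n)
     + (1 - \<alpha>) * sqrt (real n * (real n + real q - real k - 2)
                      + (real k + 1) * (real k + 1 - real q))"

subsection \<open>The extremal graphs\<close>

definition complete_bipartite :: "nat \<Rightarrow> nat \<Rightarrow> (nat + nat) pair_pre_digraph" where
  "complete_bipartite m n =
     (let X = Inl ` {..<m}; Y = Inr ` {..<n} in \<lparr> pverts = X \<union> Y, parcs = X \<times> Y \<union> Y \<times> X \<rparr>)"

text \<open>
  Up to isomorphism the choice of $X_1$, $Y_1$ and $e = uv$ is immaterial. Here
  $X_1$ is \<open>Inl ` {..<n - k}\<close>, $Y_1$ is \<open>Inr ` {..<b}\<close>, $u$ is \<open>Inr b\<close> and $v$ is \<open>Inl 0\<close>; the conditions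
  \<open>k < n\<close>, \<open>k + 1 \<le> a\<close> and \<open>1 \<le> b\<close> are presupposed.
\<close>

definition Z_graph :: "nat \<Rightarrow> nat \<Rightarrow> nat \<Rightarrow> nat \<Rightarrow> (nat + nat) pair_pre_digraph" where
  "Z_graph n k a b =
     delete_edges (complete_bipartite n (a + b)) (Inl ` {..<n - k}) (Inr ` {..<b})"

definition Z0_graph :: "nat \<Rightarrow> nat \<Rightarrow> nat \<Rightarrow> nat \<Rightarrow> (nat + nat) pair_pre_digraph" where
  "Z0_graph n k a b = delete_edges (Z_graph n k a b) {Inr b} {Inl 0}"

lemma complete_bipartite_is_K: "complete_bipartite_digraph m n (with_proj (complete_bipartite m n))"
  unfolding complete_bipartite_digraph_pair_def complete_bipartite_def Let_def
  by (intro conjI exI[of _ "Inl ` {..<m}"] exI[of _ "Inr ` {..<n}"]) (auto simp: card_image)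

lemma pair_graph_delete_edges:
  assumes "pair_graph G" shows "pair_graph (delete_edges G A B)"
proof -
  interpret pair_graph G by fact
  have "sym (parcs G)" using pair_sym_arcs by (simp add: symmetric_def)
  then show ?thesis
    by unfold_locales
      (auto simp: delete_edges_def symmetric_def sym_def pair_finite_verts pair_finite_arcs
        dest: in_arcsD1 in_arcsD2 pair_no_loops)
qed

lemma pair_graph_Z_graph: "pair_graph (Z_graph n k a b)"
  and pair_graph_Z0_graph: "pair_graph (Z0_graph n k a b)"
  unfolding Z0_graph_def Z_graph_def
  by (intro pair_graph_delete_edges pair_graphI_complete_bipartite[OF complete_bipartite_is_K])+

lemma Z_graph_deleted_edge:
  assumes "k < n" "k + 1 \<le> a" "1 \<le> b"
  shows "(Inr b, Inl 0) \<in> parcs (Z_graph n k a b)"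
    and "out_degree (with_proj (Z_graph n k a b)) (Inr b) = n"
    and "out_degree (with_proj (Z_graph n k a b)) (Inl 0) = a"
proof -
  show "(Inr b, Inl 0) \<in> parcs (Z_graph n k a b)"
    using assms by (auto simp: Z_graph_def delete_edges_def complete_bipartite_def)
  have "out_arcs (with_proj (Z_graph n k a b)) (Inr b) = {Inr b} \<times> Inl ` {..<n}"
    using assms by (auto simp: Z_graph_def delete_edges_def complete_bipartite_def out_arcs_def)
  then show "out_degree (with_proj (Z_graph n k a b)) (Inr b) = n"
    by (simp add: out_degree_def card_cartesian_product card_image)
  have "out_arcs (with_proj (Z_graph n k a b)) (Inl 0) = {Inl 0} \<times> Inr ` {b..<a + b}"
    using assms by (auto simp: Z_graph_def delete_edges_def complete_bipartite_def out_arcs_def image_iff)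
  then show "out_degree (with_proj (Z_graph n k a b)) (Inl 0) = a"
    by (simp add: out_degree_def card_cartesian_product card_image)
qed

end

theory Submission
  imports Defs "HOL-Analysis.Function_Topology" "HOL-Analysis.L2_Norm"
begin

text \<open>
  Let \<open>X\<close> be the larger and \<open>Y\<close> the smaller class, so \<open>card X = n\<close> and \<open>card Y = n - 1\<close>, and let \<open>e\<close> be the
  number of edges.

  \<^bold>\<open>From eigenvalues to edges.\<close> \<open>\<Theta>\<close> is the maximum of a Rayleigh quotient, and its quadratic form is a
  convex combination of those of the adjacency matrix and of the signless Laplacian. They are bounded by
  $\sqrt{e}$ (\<open>edge_form_0_le\<close>) and by \<open>n + e / n\<close> (\<open>edge_form_1_le\<close>). The function \<open>\<Omega>\<close> is the resulting
  bound for \<open>n (n - 1) - (k + 1 - q)(n - k - 1)\<close> edges, so \<open>\<Theta> > \<Omega>\<close> says that fewer than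
  \<open>(k + 1 - q)(n - k - 1)\<close> pairs in \<open>X \<times> Y\<close> are nonadjacent.

  \<^bold>\<open>Graphs with few nonadjacent pairs.\<close> Suppose that deleting \<open>S\<close> leaves no spanning path. Adding a
  vertex adjacent to all remaining vertices of \<open>X\<close> turns this into a balanced graph without a Hamiltonian
  cycle. Make it edge-maximal with this property; then nonadjacent pairs have small degree sum by Ore's
  argument, and counting nonadjacent pairs leaves only one possibility
  (\<open>closed_sparse_complement\<close>): there are \<open>k - q\<close> vertices of \<open>Y\<close> with at most \<open>k - q\<close> neighbours
  altogether outside \<open>S\<close>, hence at most \<open>k\<close> in the graph. This says that the graph is contained in \<open>Z\<close>, which is the first part.

  \<^bold>\<open>The extremal graphs.\<close> If \<open>n\<close> is large, \<open>Z\<^sup>0\<close> itself exceeds \<open>\<Omega>\<close> because it contains a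
  complete bipartite graph minus one edge (\<open>Omega_less_Theta_Z0_graph\<close>). So in the second part the graph
  again lies in \<open>Z\<close>. If it is not \<open>Z\<close>, it lacks an edge of \<open>Z\<close>, and the minimum degree protects the edges at
  the \<open>k - q\<close> special vertices. Unless the missing edge already leads to \<open>Z\<^sup>0\<close>, moving edges towards
  larger entries of a nonnegative maximiser turns \<open>Z\<close> minus this edge into \<open>Z\<^sup>0\<close> without decreasing \<open>\<Theta>\<close>.
  A positivity argument in the style of Perron and Frobenius makes the comparison strict unless the graph
  is \<open>Z\<^sup>0\<close> (\<open>Theta_less_Theta_Z0_graph\<close>).
\<close>

section \<open>Non-Hamiltonian balanced bipartite graphs with few nonadjacent pairs\<close>

text \<open>
  An edge traversed back and forth counts as a cycle on its two endpoints; cutting a cycle at a vertex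
  leaves a path on the others in this case, too.
\<close>
definition hamiltonian_cycle :: "'b rel \<Rightarrow> 'b set \<Rightarrow> 'b list \<Rightarrow> bool" where
  "hamiltonian_cycle E W xs \<longleftrightarrow> xs \<noteq> [] \<and> distinct xs \<and> set xs = W \<and>
     successively (\<lambda>x y. (x, y) \<in> E) xs \<and> (last xs, hd xs) \<in> E"

lemma hamiltonian_cycle_rotate:
  "hamiltonian_cycle E W (xs @ ys) \<Longrightarrow> hamiltonian_cycle E W (ys @ xs)"
  by (cases "xs = []"; cases "ys = []") (auto simp: hamiltonian_cycle_def successively_append_iff)

lemma hamiltonian_cycle_start:
  assumes "hamiltonian_cycle E W xs" "a \<in> W"
  obtains ys where "hamiltonian_cycle E W (a # ys)"
proof -
  obtain us vs where "xs = us @ a # vs"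
    using assms split_list[of a xs] by (auto simp: hamiltonian_cycle_def)
  then show ?thesis using hamiltonian_cycle_rotate[of E W us "a # vs"] assms(1) that by auto
qed

text \<open>
  If adding the edge \<open>uv\<close> creates a Hamiltonian cycle, that cycle must run through \<open>uv\<close>, and cutting it
  there leaves a Hamiltonian path between \<open>u\<close> and \<open>v\<close>. With only two vertices the cycle would traverse
  the single edge \<open>uv\<close> back and forth and nothing would remain after the cut, whence the size bound.
\<close>
lemma hamiltonian_path_of_added_edge:
  assumes sym: "sym E" and "u \<noteq> v" and W: "2 < card W"
    and ham: "hamiltonian_cycle (E \<union> {(u, v), (v, u)}) W xs" and "u \<in> W"
    and nonham: "\<And>ys. \<not> hamiltonian_cycle E W ys"
  obtains ys where "ys \<noteq> []" "distinct ys" "set ys = W" "successively (\<lambda>x y. (x, y) \<in> E) ys"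
    "hd ys = u" "last ys = v"
proof -
  obtain zs where z: "hamiltonian_cycle (E \<union> {(u, v), (v, u)}) W (u # zs)"
    using hamiltonian_cycle_start[OF ham \<open>u \<in> W\<close>] .
  have card_zs: "card W = Suc (length zs)"
    using z distinct_card[of "u # zs"] by (auto simp: hamiltonian_cycle_def)
  then have ne: "zs \<noteq> []" using W by auto
  have hdlast: "hd zs \<noteq> last zs"
    using card_zs W z ne by (cases zs) (auto simp: hamiltonian_cycle_def split: if_splits)
  have u: "u \<notin> set zs" and d: "distinct zs" and set: "insert u (set zs) = W"
    using z by (auto simp: hamiltonian_cycle_def)
  have first: "(u, hd zs) \<in> E \<or> hd zs = v" and last: "(last zs, u) \<in> E \<or> last zs = v"
    using z ne \<open>u \<noteq> v\<close> by (auto simp: hamiltonian_cycle_def successively_Cons)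
  have "successively (\<lambda>x y. (x, y) \<in> E \<union> {(u, v), (v, u)}) zs"
    using z ne by (auto simp: hamiltonian_cycle_def successively_Cons)
  then have suc: "successively (\<lambda>x y. (x, y) \<in> E) zs"
    by (rule successively_mono) (use u in auto)
  show ?thesis
  proof (cases "hd zs = v")
    case True
    then have "(u, last zs) \<in> E" using last hdlast sym by (auto dest: symD)
    moreover have "successively (\<lambda>x y. (y, x) \<in> E) zs"
      using suc by (rule successively_mono) (use sym in \<open>auto dest: symD\<close>)
    ultimately show ?thesis
      using True ne u d set by (intro that[of "u # rev zs"])
        (auto simp: successively_Cons hd_rev last_rev)
  next
    case False
    then have f: "(u, hd zs) \<in> E" using first by auto
    then have "(last zs, u) \<notin> E"
      using nonham[of "u # zs"] suc u d set ne by (auto simp: hamiltonian_cycle_def successively_Cons)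
    then show ?thesis
      using last f ne u d set suc by (intro that[of "u # zs"]) (auto simp: successively_Cons)
  qed
qed

text \<open>
  Ore's crossing argument. If \<open>u\<close> is adjacent to the successor of \<open>w\<close> on the path, and \<open>v\<close> is adjacent to
  \<open>w\<close> itself, then reversing the part of the path behind \<open>w\<close> closes it up to a cycle. Hence the
  predecessors of the neighbours of \<open>u\<close> avoid the neighbours of \<open>v\<close>. In the bipartite case both of these
  sets lie in \<open>U\<close>, which yields the bound \<open>card U\<close>, half of what the general argument gives.
\<close>
lemma ore_bipartite:
  assumes fin: "finite U" "finite V" and disj: "U \<inter> V = {}" and R: "R \<subseteq> U \<times> V"
    and uv: "u \<in> U" "v \<in> V"
    and path: "distinct ys" "set ys = U \<union> V" "successively (\<lambda>x y. (x, y) \<in> R \<union> R\<inverse>) ys"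
      "hd ys = u" "last ys = v"
    and nonham: "\<And>xs. \<not> hamiltonian_cycle (R \<union> R\<inverse>) (U \<union> V) xs"
  shows "card (R `` {u}) + card (R\<inverse> `` {v}) \<le> card U"
proof -
  define I where "I = {i. Suc i < length ys \<and> ys ! Suc i \<in> R `` {u}}"
  define D where "D = (\<lambda>i. ys ! i) ` I"
  have ne: "ys \<noteq> []" using path uv by auto
  have finI: "finite I" by (rule finite_subset[of _ "{..<length ys}"]) (auto simp: I_def)
  have "R `` {u} = (\<lambda>i. ys ! Suc i) ` I"
  proof
    show "R `` {u} \<subseteq> (\<lambda>i. ys ! Suc i) ` I"
    proof
      fix w assume w: "w \<in> R `` {u}"
      then have "w \<in> V" "w \<in> set ys" using R path by auto
      then obtain j where j: "j < length ys" "ys ! j = w" by (auto simp: in_set_conv_nth)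
      have "j \<noteq> 0" using j path(4) ne \<open>w \<in> V\<close> disj uv by (auto simp: hd_conv_nth)
      then show "w \<in> (\<lambda>i. ys ! Suc i) ` I"
        using j w by (intro image_eqI[of _ _ "j - 1"]) (auto simp: I_def)
    qed
  qed (auto simp: I_def)
  moreover have "inj_on (\<lambda>i. ys ! Suc i) I"
    using path(1) by (auto simp: inj_on_def I_def nth_eq_iff_index_eq)
  ultimately have "card (R `` {u}) = card I" by (simp only: card_image)
  also have "\<dots> = card D"
    unfolding D_def using path(1)
    by (simp add: card_image inj_on_def I_def nth_eq_iff_index_eq)
  finally have cD: "card (R `` {u}) = card D" .
  have link: "(ys ! i, ys ! Suc i) \<in> R \<union> R\<inverse>" if "Suc i < length ys" for i
  proof -
    have "successively (\<lambda>x y. (x, y) \<in> R \<union> R\<inverse>) (take (Suc i) ys @ drop (Suc i) ys)"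
      using path(3) by simp
    then show ?thesis
      using that unfolding successively_append_iff
      by (auto simp: take_Suc_conv_app_nth hd_drop_conv_nth)
  qed
  have DU: "D \<subseteq> U"
  proof
    fix x assume "x \<in> D"
    then obtain i where i: "i \<in> I" "x = ys ! i" by (auto simp: D_def)
    then have "ys ! Suc i \<in> V" using R by (auto simp: I_def)
    then show "x \<in> U" using link[of i] i R disj by (auto simp: I_def)
  qed
  have "D \<inter> R\<inverse> `` {v} = {}"
  proof (rule ccontr)
    assume "D \<inter> R\<inverse> `` {v} \<noteq> {}"
    then obtain i where i: "Suc i < length ys" "(u, ys ! Suc i) \<in> R" "(ys ! i, v) \<in> R"
      by (auto simp: D_def I_def)
    define A where "A = take (Suc i) ys"
    define B where "B = drop (Suc i) ys"
    have AB: "ys = A @ B" "A \<noteq> []" "B \<noteq> []" using i by (auto simp: A_def B_def)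
    have la: "last A = ys ! i" and hb: "hd B = ys ! Suc i" and ha: "hd A = u" and lb: "last B = v"
      using i path(4,5) ne
      by (auto simp: A_def B_def take_Suc_conv_app_nth hd_drop_conv_nth hd_append hd_conv_nth)
    have "successively (\<lambda>x y. (x, y) \<in> R \<union> R\<inverse>) B"
      using path(3) unfolding AB(1) successively_append_iff by simp
    then have "successively (\<lambda>x y. (y, x) \<in> R \<union> R\<inverse>) B"
      by (rule successively_mono) auto
    then have "hamiltonian_cycle (R \<union> R\<inverse>) (U \<union> V) (A @ rev B)"
      using path AB la hb ha lb i
      by (auto simp: hamiltonian_cycle_def successively_append_iff hd_rev last_rev)
    then show False using nonham by blast
  qed
  moreover have "R\<inverse> `` {v} \<subseteq> U" using R by auto
  ultimately have "card (D \<union> R\<inverse> `` {v}) \<le> card U" "card (D \<union> R\<inverse> `` {v}) = card D + card (R\<inverse> `` {v})"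
    using DU fin by (auto intro!: card_mono card_Un_disjoint intro: finite_subset)
  then show ?thesis using cD by simp
qed

lemma hamiltonian_cycle_complete_bipartite:
  assumes "finite U" "finite V" "U \<inter> V = {}" "card U = card V" "U \<noteq> {}"
  obtains xs where "hamiltonian_cycle (U \<times> V \<union> V \<times> U) (U \<union> V) xs"
proof -
  have "\<exists>xs. xs \<noteq> [] \<and> distinct xs \<and> set xs = U \<union> V \<and> hd xs \<in> U \<and> last xs \<in> V \<and>
      successively (\<lambda>x y. (x, y) \<in> U \<times> V \<union> V \<times> U) xs"
    using assms
  proof (induction "card U" arbitrary: U V)
    case (Suc m)
    then obtain u v where uv: "u \<in> U" "v \<in> V" by fastforce
    show ?case
    proof (cases "m = 0")
      case True
      then have "card U = 1" "card V = 1" using Suc by auto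
      then obtain u' v' where "U = {u'}" "V = {v'}" by (metis card_1_singletonE)
      then have "U = {u}" "V = {v}" using uv by auto
      then show ?thesis using Suc by (intro exI[of _ "[u, v]"]) auto
    next
      case False
      have "\<exists>xs. xs \<noteq> [] \<and> distinct xs \<and> set xs = (U - {u}) \<union> (V - {v}) \<and> hd xs \<in> U - {u} \<and> last xs \<in> V - {v} \<and>
          successively (\<lambda>x y. (x, y) \<in> (U - {u}) \<times> (V - {v}) \<union> (V - {v}) \<times> (U - {u})) xs"
      proof (rule Suc(1))
        show "m = card (U - {u})" using Suc uv by auto
        with False show "U - {u} \<noteq> {}" by (metis card.empty)
      qed (use Suc uv in auto)
      then obtain xs where xs: "xs \<noteq> []" "distinct xs" "set xs = (U - {u}) \<union> (V - {v})"
         "hd xs \<in> U - {u}" "last xs \<in> V - {v}"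
         "successively (\<lambda>x y. (x, y) \<in> (U - {u}) \<times> (V - {v}) \<union> (V - {v}) \<times> (U - {u})) xs"
        by blast
      have "successively (\<lambda>x y. (x, y) \<in> U \<times> V \<union> V \<times> U) xs"
        using xs(6) by (rule successively_mono) auto
      then show ?thesis using xs uv Suc by (intro exI[of _ "u # v # xs"])
          (auto simp: successively_Cons)
    qed
  qed auto
  then show ?thesis using that by (auto simp: hamiltonian_cycle_def)
qed

text \<open>
  Nonadjacent pairs are counted by their endpoint in \<open>V\<close>, since the lower bounds below come from
  vertices of small degree in \<open>V\<close>.
\<close>
lemma card_nonedges:
  assumes "finite U" "finite V" "R \<subseteq> U \<times> V"
  shows "card (U \<times> V - R) = (\<Sum>v\<in>V. card U - card (R\<inverse> `` {v}))"
proof -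
  have "(U \<times> V - R)\<inverse> = (SIGMA v:V. U - R\<inverse> `` {v})" using assms(3) by auto
  then have "card (U \<times> V - R) = (\<Sum>v\<in>V. card (U - R\<inverse> `` {v}))"
    using assms by (metis card_SigmaI card_inverse finite_Diff)
  also have "\<dots> = (\<Sum>v\<in>V. card U - card (R\<inverse> `` {v}))"
    using assms by (intro sum.cong refl card_Diff_subset) (auto intro: finite_subset)
  finally show ?thesis .
qed

text \<open>
  Take a nonadjacent pair \<open>(u, v)\<close> with largest degree sum \<open>i + j\<close>. Each of the \<open>p - i\<close> nonneighbours of
  \<open>u\<close> has degree at most \<open>j\<close>, so at least \<open>(p - i)(p - j) \<ge> (p - i) i\<close> pairs are nonadjacent. This is at
  least \<open>s (p - s)\<close> as long as \<open>s \<le> i \<le> p - s\<close>, so few nonadjacent pairs force \<open>i = p - s + 1\<close> and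
  \<open>j = s - 1\<close>: the nonneighbours of \<open>u\<close> form a set \<open>B\<close> of \<open>s - 1\<close> vertices of the least possible degree.

  They share their neighbourhood: a vertex \<open>a\<close> adjacent to one member of \<open>B\<close> but not to another has degree
  at most \<open>p - s + 1\<close>, so it misses \<open>s - 1\<close> vertices, of which at most \<open>s - 2\<close> lie in \<open>B\<close>. Each vertex outside \<open>B\<close>
  that it misses in turn misses at least as many vertices as \<open>a\<close> has neighbours. Together with the pairs missing at \<open>B\<close> this is too much.
\<close>
lemma closed_sparse_complement:
  assumes fin: "finite U" "finite V" and cU: "card U = p" and cV: "card V = p"
    and R: "R \<subseteq> U \<times> V" "R \<noteq> U \<times> V"
    and closed: "\<And>u v. u \<in> U \<Longrightarrow> v \<in> V \<Longrightarrow> (u, v) \<notin> R \<Longrightarrow> card (R `` {u}) + card (R\<inverse> `` {v}) \<le> p"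
    and dU: "\<And>u. u \<in> U \<Longrightarrow> s \<le> card (R `` {u})"
    and dV: "\<And>v. v \<in> V \<Longrightarrow> s - 1 \<le> card (R\<inverse> `` {v})"
    and few: "card (U \<times> V - R) < s * (p - s)" 
  obtains B where "B \<subseteq> V" "card B = s - 1" "card (R\<inverse> `` B) \<le> s - 1"
proof -
  define M where "M = U \<times> V - R"
  define f where "f = (\<lambda>(u, v). card (R `` {u}) + card (R\<inverse> `` {v}))"
  have "finite M" "M \<noteq> {}" using fin R by (auto simp: M_def)
  then have "Max (f ` M) \<in> f ` M" by simp
  then obtain u v where uv: "u \<in> U" "v \<in> V" "(u, v) \<notin> R" and "f (u, v) = Max (f ` M)"
    by (auto simp: M_def)
  then have max: "f (a, b) \<le> f (u, v)" if "a \<in> U" "b \<in> V" "(a, b) \<notin> R" for a b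
    using that \<open>finite M\<close> by (simp add: M_def)
  have finR: "finite (R `` {a})" "finite (R\<inverse> `` A)" for a A
    using R fin by (auto intro: finite_subset[of _ V] finite_subset[of _ U])
  have s: "1 \<le> s" "s < p" using few by (cases s; auto intro: ccontr)+
  define i where "i = card (R `` {u})"
  define j where "j = card (R\<inverse> `` {v})"
  define B where "B = V - R `` {u}"
  have ij: "i + j \<le> p" "s \<le> i" "s - 1 \<le> j" using closed uv dU dV by (auto simp: i_def j_def)
  have dB: "card (R\<inverse> `` {b}) \<le> j" if "b \<in> B" for b
    using max[of u b] that uv by (auto simp: B_def f_def i_def j_def)
  have cB: "card B = p - i"
    unfolding B_def i_def using R finR cV by (subst card_Diff_subset) auto
  have nonedges: "card M = (\<Sum>b\<in>V. p - card (R\<inverse> `` {b}))"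
    unfolding M_def using card_nonedges[OF fin R(1)] cU by simp
  have "(p - i) * (p - j) = (\<Sum>b\<in>B. p - j)" using cB by simp
  also have "\<dots> \<le> (\<Sum>b\<in>B. p - card (R\<inverse> `` {b}))" by (intro sum_mono diff_le_mono2 dB)
  also have "\<dots> \<le> card M" unfolding nonedges by (intro sum_mono2) (auto simp: B_def fin)
  finally have "(p - i) * (p - j) < s * (p - s)" using few by (simp add: M_def)
  moreover have "(p - i) * i \<le> (p - i) * (p - j)" using ij by (intro mult_le_mono) auto
  ultimately have low: "(p - i) * i < s * (p - s)" by linarith
  \<comment> \<open>The concave function \<open>i (p - i)\<close> is at least \<open>s (p - s)\<close> between \<open>s\<close> and \<open>p - s\<close>.\<close>
  have "p - s < i"
  proof (rule ccontr)
    assume "\<not> p - s < i"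
    then obtain c where c: "p = i + s + c" using s by (metis Nat.le_diff_conv2 add.commute le_add_diff_inverse nat_le_iff_add not_less less_imp_le)
    obtain d where d: "i = s + d" using ij(2) by (metis le_add_diff_inverse)
    show False using low unfolding c d by (simp add: algebra_simps)
  qed
  then have i: "i = p - s + 1" and j: "j = s - 1" using ij s by auto
  have Bs: "card B = s - 1" using cB i s by auto
  have dB': "card (R\<inverse> `` {b}) = s - 1" if "b \<in> B" for b
    using dB[OF that] dV[of b] that j by (auto simp: B_def)
  have "card (R\<inverse> `` B) \<le> s - 1"
  proof (rule ccontr)
    assume big: "\<not> card (R\<inverse> `` B) \<le> s - 1"
    then have "B \<noteq> {}" by auto
    then obtain b where b: "b \<in> B" by auto
    then have "card (R\<inverse> `` {b}) < card (R\<inverse> `` B)" using big dB' by auto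
    then have "\<not> R\<inverse> `` B \<subseteq> R\<inverse> `` {b}" using card_mono[OF finR(2)] by (meson not_less)
    then obtain a b' where a: "b' \<in> B" "(a, b') \<in> R" "(a, b) \<notin> R" by auto
    have aU: "a \<in> U" using a R by auto
    define J where "J = V - R `` {a} - B"
    define d where "d = card (R `` {a})"
    have "card (B - R `` {a}) \<le> card (B - {b'})" 
      using a fin by (intro card_mono) (auto simp: B_def)
    also have "\<dots> = s - 2" using a Bs fin by (subst card_Diff_singleton) (auto simp: B_def)
    finally have "card (B - R `` {a}) \<le> s - 2" .
    moreover have "V - R `` {a} = J \<union> (B - R `` {a})" by (auto simp: J_def B_def)
    then have "card (V - R `` {a}) \<le> card J + card (B - R `` {a})" by (metis card_Un_le)
    moreover have "card (V - R `` {a}) = p - d"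
      unfolding d_def using R finR cV by (subst card_Diff_subset) auto
    ultimately have J1: "p - d \<le> card J + (s - 2)" by simp
    have da: "d + (s - 1) \<le> p" "s \<le> d" 
      using closed[of a b] dB'[OF b] b a aU dU[of a] by (auto simp: d_def B_def)
    have "card B \<noteq> 0" using b fin by (auto simp: B_def)
    then have s2: "2 \<le> s" using Bs by auto
    have J2: "1 \<le> card J" using J1 da s2 by linarith
    have "(s - 1) * (p - (s - 1)) + card J * d = (\<Sum>b\<in>B. p - (s - 1)) + (\<Sum>w\<in>J. d)"
      using Bs by simp
    also have "\<dots> \<le> (\<Sum>b\<in>B. p - card (R\<inverse> `` {b})) + (\<Sum>w\<in>J. p - card (R\<inverse> `` {w}))"
    proof (intro add_mono sum_mono)
      fix w assume "w \<in> J"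
      then have "d + card (R\<inverse> `` {w}) \<le> p" using closed[of a w] aU by (auto simp: J_def d_def)
      then show "d \<le> p - card (R\<inverse> `` {w})" by simp
    qed (simp add: dB')
    also have "\<dots> = (\<Sum>b\<in>B \<union> J. p - card (R\<inverse> `` {b}))"
      using fin by (intro sum.union_disjoint[symmetric]) (auto simp: B_def J_def)
    also have "\<dots> \<le> card M" unfolding nonedges
      using fin by (intro sum_mono2) (auto simp: B_def J_def)
    finally have le: "(s - 1) * (p - (s - 1)) + card J * d < s * (p - s)" 
      using few by (simp add: M_def)
    obtain t where t: "s = t + 2" using s2 by (metis add.commute le_add_diff_inverse)
    obtain c where c: "p = s + c" using s by (metis less_imp_le le_add_diff_inverse)
    obtain g where g: "card J = g + 1" using J2 by (metis add.commute le_add_diff_inverse)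
    obtain h where h: "d = h + 1" using da s by (metis add.commute le_add_diff_inverse le_trans)
    have "p \<le> g + h + s" using J1 da g h s2 by linarith
    then have "c \<le> g + h" using c by simp
    then show False using le unfolding g h c t by (simp add: algebra_simps)
  qed
  then show ?thesis using Bs by (intro that[of B]) (auto simp: B_def)
qed

text \<open>
  Adding edges as long as no Hamiltonian cycle appears preserves the degree and sparsity hypotheses, and
  the conclusion passes to subgraphs. In an edge-maximal non-Hamiltonian graph every nonadjacent pair
  is joined by a Hamiltonian path, so Ore's argument bounds its degree sum by \<open>p\<close>.
\<close>
lemma nonhamiltonian_sparse_complement:
  assumes fin: "finite U" "finite V" and disj: "U \<inter> V = {}" and cU: "card U = p" and cV: "card V = p"
    and R: "R \<subseteq> U \<times> V"
    and nonham: "\<And>xs. \<not> hamiltonian_cycle (R \<union> R\<inverse>) (U \<union> V) xs"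
    and dU: "\<And>u. u \<in> U \<Longrightarrow> s \<le> card (R `` {u})"
    and dV: "\<And>v. v \<in> V \<Longrightarrow> s - 1 \<le> card (R\<inverse> `` {v})"
    and few: "card (U \<times> V - R) < s * (p - s)"
  obtains B where "B \<subseteq> V" "card B = s - 1" "card (R\<inverse> `` B) \<le> s - 1"
proof -
  define F where "F = {Q. R \<subseteq> Q \<and> Q \<subseteq> U \<times> V \<and> (\<forall>xs. \<not> hamiltonian_cycle (Q \<union> Q\<inverse>) (U \<union> V) xs)}"
  have "finite F" by (rule finite_subset[of _ "Pow (U \<times> V)"]) (auto simp: F_def fin)
  moreover have "R \<in> F" using R nonham by (auto simp: F_def)
  ultimately obtain Q where Q: "Q \<in> F" and maxQ: "\<And>Q'. Q' \<in> F \<Longrightarrow> Q \<subseteq> Q' \<Longrightarrow> Q = Q'"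
    using finite_has_maximal2[of F R] by metis
  have RQ: "R \<subseteq> Q" and QUV: "Q \<subseteq> U \<times> V"
    and nonhamQ: "\<And>xs. \<not> hamiltonian_cycle (Q \<union> Q\<inverse>) (U \<union> V) xs"
    using Q by (auto simp: F_def)
  have s: "1 \<le> s" "s < p" using few by (cases s; auto intro: ccontr)+
  have "U \<noteq> {}" using cU s by auto
  have neq: "Q \<noteq> U \<times> V"
  proof
    assume "Q = U \<times> V"
    then have "Q \<union> Q\<inverse> = U \<times> V \<union> V \<times> U" by auto
    then show False using nonhamQ
      hamiltonian_cycle_complete_bipartite[OF fin disj _ \<open>U \<noteq> {}\<close>] cU cV by metis
  qed
  have closed: "card (Q `` {u}) + card (Q\<inverse> `` {v}) \<le> p" if uv: "u \<in> U" "v \<in> V" "(u, v) \<notin> Q" for u v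
  proof -
    have "insert (u, v) Q \<notin> F" using maxQ[of "insert (u, v) Q"] uv by auto
    then obtain xs where
      xs: "hamiltonian_cycle (insert (u, v) Q \<union> (insert (u, v) Q)\<inverse>) (U \<union> V) xs"
      using uv RQ QUV by (auto simp: F_def)
    have eq: "insert (u, v) Q \<union> (insert (u, v) Q)\<inverse> = (Q \<union> Q\<inverse>) \<union> {(u, v), (v, u)}" by auto
    have "card (U \<union> V) = 2 * p" using cU cV fin disj by (simp add: card_Un_disjoint)
    then have "2 < card (U \<union> V)" using s by simp
    moreover have "u \<noteq> v" using uv disj by auto
    ultimately obtain ys where "ys \<noteq> []" "distinct ys" "set ys = U \<union> V"
      "successively (\<lambda>x y. (x, y) \<in> Q \<union> Q\<inverse>) ys" "hd ys = u" "last ys = v"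
      using hamiltonian_path_of_added_edge[OF _ _ _ xs[unfolded eq] _ nonhamQ] uv
      by (auto simp: sym_Un_converse)
    then show ?thesis
      using ore_bipartite[OF fin disj QUV uv(1,2) _ _ _ _ _ nonhamQ] cU by simp
  qed
  have finQ: "finite (Q `` A)" "finite (Q\<inverse> `` C)" for A C
    using QUV fin by (auto intro: finite_subset[of _ V] finite_subset[of _ U])
  have dUQ: "s \<le> card (Q `` {u})" if "u \<in> U" for u
    by (rule order_trans[OF dU[OF that]], rule card_mono) (use finQ RQ in auto)
  have dVQ: "s - 1 \<le> card (Q\<inverse> `` {v})" if "v \<in> V" for v
    by (rule order_trans[OF dV[OF that]], rule card_mono) (use finQ RQ in auto)
  have fewQ: "card (U \<times> V - Q) < s * (p - s)"
    by (rule le_less_trans[OF card_mono few]) (use fin RQ in auto)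
  obtain B where B: "B \<subseteq> V" "card B = s - 1" "card (Q\<inverse> `` B) \<le> s - 1"
    using closed_sparse_complement[OF fin cU cV QUV neq closed dUQ dVQ fewQ] .
  moreover have "card (R\<inverse> `` B) \<le> card (Q\<inverse> `` B)"
    using RQ by (intro card_mono finQ) auto
  ultimately show ?thesis using that by fastforce
qed

section \<open>Bipartite graphs given by their edges between the classes\<close>

definition bip_graph :: "'a set \<Rightarrow> 'a set \<Rightarrow> 'a rel \<Rightarrow> 'a pair_pre_digraph" where
  "bip_graph X Y R = \<lparr> pverts = X \<union> Y, parcs = R \<union> R\<inverse> \<rparr>"

lemma pverts_bip_graph [simp]: "pverts (bip_graph X Y R) = X \<union> Y"
  and parcs_bip_graph [simp]: "parcs (bip_graph X Y R) = R \<union> R\<inverse>"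
  by (simp_all add: bip_graph_def)

lemma bipartite_graph_eq_bip_graph:
  assumes "bipartite_graph G X Y"
  shows "G = bip_graph X Y (parcs G \<inter> X \<times> Y)"
proof -
  interpret pair_graph G using assms by (simp add: bipartite_graph_def)
  have "sym (parcs G)" using pair_sym_arcs by (simp add: symmetric_def)
  then have "parcs G = parcs G \<inter> X \<times> Y \<union> (parcs G \<inter> X \<times> Y)\<inverse>"
    using assms by (auto simp: bipartite_graph_def dest: symD)
  then show ?thesis using assms
    by (metis bip_graph_def bipartite_graph_def pair_pre_digraph.surjective old.unit.exhaust)
qed

lemma pair_graph_bip_graph:
  assumes "finite X" "finite Y" "X \<inter> Y = {}" "R \<subseteq> X \<times> Y"
  shows "pair_graph (bip_graph X Y R)"
proof -
  have "finite R" using assms by (meson finite_SigmaI finite_subset)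
  then show ?thesis
    using assms by unfold_locales (auto simp: symmetric_def sym_def)
qed

lemma out_degree_bip_graph:
  assumes "X \<inter> Y = {}" "R \<subseteq> X \<times> Y"
  shows "x \<in> X \<Longrightarrow> out_degree (with_proj (bip_graph X Y R)) x = card (R `` {x})"
    and "y \<in> Y \<Longrightarrow> out_degree (with_proj (bip_graph X Y R)) y = card (R\<inverse> `` {y})"
proof -
  have *: "out_arcs (with_proj (bip_graph X Y R)) z = Pair z ` ((R \<union> R\<inverse>) `` {z})" for z
    by (auto simp: out_arcs_def)
  have "(R \<union> R\<inverse>) `` {x} = R `` {x}" if "x \<in> X" using that assms by auto
  then show "x \<in> X \<Longrightarrow> out_degree (with_proj (bip_graph X Y R)) x = card (R `` {x})"
    by (simp add: out_degree_def * card_image inj_on_def)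
  have "(R \<union> R\<inverse>) `` {y} = R\<inverse> `` {y}" if "y \<in> Y" using that assms by auto
  then show "y \<in> Y \<Longrightarrow> out_degree (with_proj (bip_graph X Y R)) y = card (R\<inverse> `` {y})"
    by (simp add: out_degree_def * card_image inj_on_def)
qed

lemma digraph_iso_bip_graph_image:
  assumes "finite X" "finite Y" "X \<inter> Y = {}" "R \<subseteq> X \<times> Y" and inj: "inj_on f (X \<union> Y)"
  shows "digraph_iso (with_proj (bip_graph X Y R))
    (with_proj (bip_graph (f ` X) (f ` Y) (map_prod f f ` R)))"
proof -
  interpret pair_graph "bip_graph X Y R" by (rule pair_graph_bip_graph) fact+
  define h where "h = \<lparr>iso_verts = f, iso_arcs = map_prod f f, iso_head = snd, iso_tail = fst\<rparr>"
  have "inj_on (map_prod f f) ((X \<union> Y) \<times> (X \<union> Y))" using inj by (simp add: map_prod_inj_on)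
  then have "inj_on (map_prod f f) (R \<union> R\<inverse>)"
    by (rule inj_on_subset) (use assms in auto)
  then have "pre_digraph.digraph_isomorphism (with_proj (bip_graph X Y R)) h"
    using inj wf_digraph_axioms by (auto simp: pre_digraph.digraph_isomorphism_def h_def)
  moreover have "with_proj (bip_graph (f ` X) (f ` Y) (map_prod f f ` R)) =
      app_iso h (with_proj (bip_graph X Y R))"
    by (auto simp: with_proj_def app_iso_def h_def bip_graph_def image_Un)
  ultimately show ?thesis unfolding digraph_iso_def by blast
qed

lemma embeds_bip_graph_image:
  assumes "finite X" "finite Y" "X \<inter> Y = {}" "Q \<subseteq> X \<times> Y" "R \<subseteq> Q" and inj: "inj_on f (X \<union> Y)"
  shows "embeds (bip_graph X Y R) (bip_graph (f ` X) (f ` Y) (map_prod f f ` Q))"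
  unfolding embeds_def
proof (intro exI conjI)
  let ?G = "with_proj (bip_graph (f ` X) (f ` Y) (map_prod f f ` R))"
  have dis: "f ` X \<inter> f ` Y = {}" using inj assms(3) by (simp add: inj_on_Un_image_eq_iff inj_on_def) blast
  have "pair_graph (bip_graph (f ` X) (f ` Y) (map_prod f f ` R))"
    "pair_graph (bip_graph (f ` X) (f ` Y) (map_prod f f ` Q))"
    using assms by (auto intro!: pair_graph_bip_graph dis simp: dis)
  then have "wf_digraph ?G" "wf_digraph (with_proj (bip_graph (f ` X) (f ` Y) (map_prod f f ` Q)))"
    by (auto simp: pair_graph_def pair_digraph_def pair_fin_digraph_def intro: wf_digraph_wp_iff[THEN iffD2])
  then show "subgraph ?G (with_proj (bip_graph (f ` X) (f ` Y) (map_prod f f ` Q)))"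
    using assms by (auto simp: subgraph_def compatible_def)
  show "digraph_iso (with_proj (bip_graph X Y R)) ?G"
    by (rule digraph_iso_bip_graph_image) (use assms in auto)
qed

lemma Z_graph_eq_bip_graph:
  "Z_graph n k a b = bip_graph (Inl ` {..<n}) (Inr ` {..<a + b})
     (Inl ` {..<n} \<times> Inr ` {..<a + b} - Inl ` {..<n - k} \<times> Inr ` {..<b})"
  by (auto simp: Z_graph_def delete_edges_def complete_bipartite_def bip_graph_def Let_def)

lemma Z0_graph_eq_bip_graph:
  "Z0_graph n k a b = bip_graph (Inl ` {..<n}) (Inr ` {..<a + b})
     (Inl ` {..<n} \<times> Inr ` {..<a + b} - Inl ` {..<n - k} \<times> Inr ` {..<b} - {(Inl 0, Inr b)})"
  by (auto simp: Z0_graph_def Z_graph_def delete_edges_def complete_bipartite_def bip_graph_def Let_def)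

lemma bij_betw_pointed:
  assumes "finite A" "finite B" "card A = card B" "a \<in> A" "b \<in> B"
  obtains f where "bij_betw f A B" "f a = b"
proof -
  have "card (A - {a}) = card (B - {b})" using assms by simp
  then obtain g where g: "bij_betw g (A - {a}) (B - {b})"
    using assms finite_same_card_bij[of "A - {a}" "B - {b}"] by auto
  have "bij_betw (g(a := b)) (insert a (A - {a})) (insert b (B - {b}))"
    using g by (auto simp: bij_betw_def inj_on_def)
  then show ?thesis using that[of "g(a := b)"] assms by (simp add: insert_absorb)
qed

lemma bij_betw_split:
  assumes "finite A" "finite B" "card A = card B" "A1 \<subseteq> A" "B1 \<subseteq> B" "card A1 = card B1"
    and "bij_betw f A1 B1"
  obtains g where "bij_betw g A B" "\<And>a. a \<in> A1 \<Longrightarrow> g a = f a" "g ` A1 = B1"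
proof -
  have "card (A - A1) = card (B - B1)"
    using assms by (simp add: card_Diff_subset finite_subset)
  then obtain h where h: "bij_betw h (A - A1) (B - B1)"
    using assms finite_same_card_bij[of "A - A1" "B - B1"] by auto
  define g where "g = (\<lambda>a. if a \<in> A1 then f a else h a)"
  have "bij_betw g A1 B1" using assms(7) by (simp add: g_def cong: bij_betw_cong)
  moreover have "bij_betw g (A - A1) (B - B1)" using h by (subst bij_betw_cong[of _ _ h]) (auto simp: g_def)
  ultimately have "bij_betw g (A1 \<union> (A - A1)) (B1 \<union> (B - B1))"
    by (rule bij_betw_combine) auto
  then have "bij_betw g A B" using assms(4,5) by (simp add: Un_absorb1)
  then show ?thesis using that[of g] \<open>bij_betw g A1 B1\<close> by (auto simp: g_def bij_betw_def)
qed

text \<open>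
  A relabelling that carries \<open>X1\<close>, \<open>Y1\<close> and a marked pair of vertices to their standard positions in
  the graphs \<open>Z\<close> and \<open>Z\<^sup>0\<close>.
\<close>
lemma relabelling:
  assumes fin: "finite X" "finite Y" and disj: "X \<inter> Y = {}" and cX: "card X = n" and cY: "card Y = a + b"
    and X1: "X1 \<subseteq> X" "card X1 = n - k" "x \<in> X1" and Y1: "Y1 \<subseteq> Y" "card Y1 = b" "y \<in> Y" "y \<notin> Y1"
  obtains f :: "'a \<Rightarrow> nat + nat" where "inj_on f (X \<union> Y)" "f ` X = Inl ` {..<n}" "f ` Y = Inr ` {..<a + b}"
    "f ` X1 = Inl ` {..<n - k}" "f ` Y1 = Inr ` {..<b}" "f x = Inl 0" "f y = Inr b"
proof -
  have finX1: "finite X1" and finY1: "finite Y1" using X1 Y1 fin by (auto intro: finite_subset)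
  have "n - k > 0" using X1 finX1 by (metis card_gt_0_iff empty_iff)
  then obtain g1 :: "'a \<Rightarrow> nat" where g1: "bij_betw g1 X1 {..<n - k}" "g1 x = 0"
    using bij_betw_pointed[of X1 "{..<n - k}" x 0] X1 finX1 by auto
  obtain g where g: "bij_betw g X {..<n}" "\<And>c. c \<in> X1 \<Longrightarrow> g c = g1 c" "g ` X1 = {..<n - k}"
    by (rule bij_betw_split[OF _ _ _ X1(1) _ _ g1(1), of "{..<n}"]) (use fin cX X1 in auto)
  obtain h1 where h1: "bij_betw h1 Y1 {..<b}"
    using finite_same_card_bij[OF finY1, of "{..<b}"] Y1 by auto
  have h2: "bij_betw (h1(y := b)) (insert y Y1) (insert b {..<b})"
    using h1 Y1(4) by (auto simp: bij_betw_def inj_on_def)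
  have b: "b < a + b" using psubset_card_mono[of Y Y1] Y1 fin cY by auto
  have c: "card (insert y Y1) = card (insert b {..<b})" using Y1 finY1 by simp
  obtain h where h: "bij_betw h Y {..<a + b}" "\<And>c. c \<in> insert y Y1 \<Longrightarrow> h c = (h1(y := b)) c"
    by (rule bij_betw_split[OF _ _ _ _ _ _ h2, of Y "{..<a + b}"]) (use fin cY Y1 b c in auto)
  have hY1: "h ` Y1 = {..<b}"
  proof -
    have "h ` Y1 = h1 ` Y1" using h(2) Y1(4) by (intro image_cong) auto
    then show ?thesis using h1 by (simp add: bij_betw_def)
  qed
  define f where "f = (\<lambda>c. if c \<in> X then Inl (g c) else (Inr (h c) :: nat + nat))"
  have fX: "f ` C = Inl ` g ` C" if "C \<subseteq> X" for C
    unfolding image_image using that by (intro image_cong) (auto simp: f_def)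
  have fY: "f ` C = Inr ` h ` C" if "C \<subseteq> Y" for C
    unfolding image_image using that disj by (intro image_cong) (auto simp: f_def)
  show ?thesis
  proof
    show "inj_on f (X \<union> Y)" using g(1) h(1) disj by (auto simp: inj_on_def bij_betw_def f_def)
    show "f ` X = Inl ` {..<n}" using fX[of X] g by (simp add: bij_betw_def)
    show "f ` Y = Inr ` {..<a + b}" using fY[of Y] h by (simp add: bij_betw_def)
    show "f ` X1 = Inl ` {..<n - k}" using fX[OF X1(1)] g by simp
    show "f ` Y1 = Inr ` {..<b}" using fY[OF Y1(1)] hY1 by simp
    show "f x = Inl 0" using X1 g g1 by (auto simp: f_def)
    show "f y = Inr b" using Y1 disj h by (auto simp: f_def)
  qed
qed

section \<open>The largest eigenvalue as a maximal Rayleigh quotient\<close>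

definition quad :: "'a set \<Rightarrow> ('a \<Rightarrow> 'a \<Rightarrow> real) \<Rightarrow> ('a \<Rightarrow> real) \<Rightarrow> real" where
  "quad W M x = (\<Sum>i\<in>W. \<Sum>j\<in>W. M i j * x i * x j)"

text \<open>
  The unit sphere in the space of functions vanishing off \<open>W\<close> is a closed subset of a product of
  intervals, hence compact by Tychonoff's theorem. By homogeneity a maximum of the form on the sphere
  bounds it everywhere.
\<close>
lemma rayleigh_attained:
  fixes M :: "'a \<Rightarrow> 'a \<Rightarrow> real"
  assumes fin: "finite W" and "W \<noteq> {}"
  obtains l x where "(\<Sum>i\<in>W. (x i)\<^sup>2) = 1" "quad W M x = l"
    "\<And>y. quad W M y \<le> l * (\<Sum>i\<in>W. (y i)\<^sup>2)"
proof -
  define K :: "('a \<Rightarrow> real) set" where "K = PiE UNIV (\<lambda>i. if i \<in> W then {-1..1} else {0})"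
  define S where "S = K \<inter> {x. (\<Sum>i\<in>W. (x i)\<^sup>2) = 1}"
  have "compactin (product_topology (\<lambda>i. euclidean) UNIV) K"
    unfolding K_def compactin_PiE by auto
  then have "compact K" by (simp add: euclidean_product_topology)
  moreover have "closed {x :: 'a \<Rightarrow> real. (\<Sum>i\<in>W. (x i)\<^sup>2) = 1}"
    by (intro closed_Collect_eq continuous_intros continuous_on_product_coordinates)
  ultimately have "compact S" unfolding S_def by (rule compact_Int_closed)
  moreover have "S \<noteq> {}"
  proof -
    obtain w where "w \<in> W" using \<open>W \<noteq> {}\<close> by auto
    then have "(\<lambda>i. if i = w then 1 else 0) \<in> S"
      using fin by (auto simp: S_def K_def if_distrib[of "\<lambda>c. c\<^sup>2"] cong: if_cong)
    then show ?thesis by auto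
  qed
  moreover have "continuous_on S (quad W M)"
    unfolding quad_def
    by (intro continuous_intros continuous_on_subset[OF continuous_on_product_coordinates]) auto
  ultimately obtain x where x: "x \<in> S" "\<And>y. y \<in> S \<Longrightarrow> quad W M y \<le> quad W M x"
    using continuous_attains_sup[of S "quad W M"] by blast
  have "quad W M y \<le> quad W M x * (\<Sum>i\<in>W. (y i)\<^sup>2)" for y
  proof (cases "(\<Sum>i\<in>W. (y i)\<^sup>2) = 0")
    case True
    then have "y i = 0" if "i \<in> W" for i using that fin by (simp add: sum_nonneg_eq_0_iff)
    then show ?thesis by (simp add: quad_def)
  next
    case False
    define c where "c = (\<Sum>i\<in>W. (y i)\<^sup>2)"
    have c: "c > 0" using False sum_nonneg[of W "\<lambda>i. (y i)\<^sup>2"] by (simp add: c_def less_le)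
    define z where "z = (\<lambda>i. if i \<in> W then y i / sqrt c else 0)"
    have "(\<Sum>i\<in>W. (z i)\<^sup>2) = (\<Sum>i\<in>W. (y i)\<^sup>2 / c)"
      using c by (intro sum.cong) (auto simp: z_def power_divide)
    also have "\<dots> = 1" using c by (simp add: c_def flip: sum_divide_distrib)
    finally have z1: "(\<Sum>i\<in>W. (z i)\<^sup>2) = 1" .
    have "z i \<in> {-1..1}" if "i \<in> W" for i
    proof -
      have "(z i)\<^sup>2 \<le> 1" using member_le_sum[OF that _ fin, of "\<lambda>i. (z i)\<^sup>2"] z1 by simp
      then show ?thesis using abs_square_le_1[of "z i"] by (simp add: abs_le_iff)
    qed
    then have "z \<in> S" using z1 by (auto simp: S_def K_def) (auto simp: z_def)
    then have "quad W M z \<le> quad W M x" by (rule x(2))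
    moreover have "quad W M z = quad W M y / c"
      unfolding quad_def sum_divide_distrib using c
      by (intro sum.cong) (auto simp: z_def)
    ultimately show ?thesis using c by (simp add: c_def[symmetric] divide_simps mult.commute)
  qed
  then show ?thesis using x(1) by (intro that[of x]) (auto simp: S_def)
qed

text \<open>
  First-order condition: perturbing coordinate \<open>k\<close> of a maximiser by \<open>t\<close> changes
  \<open>l \<parallel>x\<parallel>\<^sup>2 - x\<^sup>T M x\<close> by \<open>2 t a + t\<^sup>2 b\<close>, where \<open>a\<close> is the defect of the eigenvalue equation in row \<open>k\<close>.
  This is nonnegative for all \<open>t\<close> only if \<open>a = 0\<close>.
\<close>
lemma maximiser_is_eigenvector:
  fixes M :: "'a \<Rightarrow> 'a \<Rightarrow> real"
  assumes fin: "finite W" and sym: "\<And>i j. i \<in> W \<Longrightarrow> j \<in> W \<Longrightarrow> M i j = M j i"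
    and le: "\<And>y. quad W M y \<le> l * (\<Sum>i\<in>W. (y i)\<^sup>2)" and eq: "quad W M x = l * (\<Sum>i\<in>W. (x i)\<^sup>2)"
    and k: "k \<in> W"
  shows "(\<Sum>j\<in>W. M k j * x j) = l * x k"
proof -
  define a where "a = l * x k - (\<Sum>j\<in>W. M k j * x j)"
  define b where "b = l - M k k"
  have ineq: "0 \<le> 2 * t * a + t\<^sup>2 * b" for t
  proof -
    define e where "e = (\<lambda>i. if i = k then 1 else (0 :: real))"
    define y where "y = (\<lambda>i. x i + t * e i)"
    have d: "(\<Sum>i\<in>W. f i * e i) = f k" for f
      using fin k by (simp add: e_def if_distrib cong: if_cong)
    have "(\<Sum>i\<in>W. (y i)\<^sup>2) = (\<Sum>i\<in>W. (x i)\<^sup>2 + 2 * t * (x i * e i) + t\<^sup>2 * (e i * e i))"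
      by (intro sum.cong) (auto simp: y_def power2_eq_square algebra_simps)
    also have "\<dots> = (\<Sum>i\<in>W. (x i)\<^sup>2) + 2 * t * x k + t\<^sup>2 * e k"
      by (simp add: sum.distrib sum_distrib_left[symmetric] d)
    finally have sq: "(\<Sum>i\<in>W. (y i)\<^sup>2) = (\<Sum>i\<in>W. (x i)\<^sup>2) + 2 * t * x k + t\<^sup>2" by (simp add: e_def)
    have "quad W M y = (\<Sum>i\<in>W. \<Sum>j\<in>W. M i j * x i * x j + t * (M i j * x j * e i) + t * (M i j * x i * e j)
        + t\<^sup>2 * (M i j * e i * e j))"
      unfolding quad_def by (intro sum.cong) (auto simp: y_def power2_eq_square algebra_simps)
    also have "\<dots> = quad W M x + t * (\<Sum>i\<in>W. (\<Sum>j\<in>W. M i j * x j) * e i) + t * (\<Sum>i\<in>W. \<Sum>j\<in>W. M i j * x i * e j)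
        + t\<^sup>2 * (\<Sum>i\<in>W. \<Sum>j\<in>W. M i j * e i * e j)"
      by (simp add: sum.distrib sum_distrib_left sum_distrib_right quad_def)
    also have "\<dots> = quad W M x + t * (\<Sum>j\<in>W. M k j * x j) + t * (\<Sum>i\<in>W. M i k * x i) + t\<^sup>2 * M k k"
      by (simp add: d)
    also have "(\<Sum>i\<in>W. M i k * x i) = (\<Sum>j\<in>W. M k j * x j)"
      using sym k by (intro sum.cong) auto
    finally show ?thesis using le[of y] eq unfolding sq a_def b_def by (simp add: algebra_simps)
  qed
  \<comment> \<open>The choice \<open>t = - a / c\<close> makes the linear term dominate.\<close>
  define c where "c = \<bar>b\<bar> + 1"
  have c: "c > 0" "b \<le> c" by (auto simp: c_def)
  have "2 * (- a / c) * a + (- a / c)\<^sup>2 * b = (a\<^sup>2 / c) * (b / c - 2)"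
    using c by (simp add: power2_eq_square field_simps)
  then have "0 \<le> (a\<^sup>2 / c) * (b / c - 2)" using ineq[of "- a / c"] by simp
  moreover have "b / c - 2 \<le> -1" using c by (simp add: field_simps)
  then have "(a\<^sup>2 / c) * (b / c - 2) \<le> (a\<^sup>2 / c) * (-1)" using c by (intro mult_left_mono) auto
  ultimately have "a\<^sup>2 / c \<le> 0" by linarith
  then have "a = 0" using c by (simp add: field_simps)
  then show ?thesis by (simp add: a_def)
qed

definition graph_matrix :: "'a pair_pre_digraph \<Rightarrow> real \<Rightarrow> 'a \<Rightarrow> 'a \<Rightarrow> real" where
  "graph_matrix G \<alpha> u v = (if (u, v) \<in> parcs G then 1 else 0) +
     (if u = v then \<alpha> * real (out_degree (with_proj G) u) else 0)"

text \<open>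
  For a symmetric matrix the maximum of the Rayleigh quotient is an eigenvalue, since a maximiser is an
  eigenvector, and every eigenvalue is a value of the quotient. This frees the later arguments from
  vertex labellings and matrices.
\<close>
lemma Theta_rayleigh:
  assumes fin: "finite (pverts G)" and ne: "pverts G \<noteq> {}" and sym: "sym (parcs G)"
  obtains x where "(\<Sum>i\<in>pverts G. (x i)\<^sup>2) = 1" "quad (pverts G) (graph_matrix G \<alpha>) x = Theta G \<alpha>"
    "\<And>y. quad (pverts G) (graph_matrix G \<alpha>) y \<le> Theta G \<alpha> * (\<Sum>i\<in>pverts G. (y i)\<^sup>2)"
proof -
  define N where "N = card (pverts G)"
  let ?c = "graph_matrix G \<alpha>"
  obtain f where fb: "bij_betw f {..<N} (pverts G)"
    using ex_bij_betw_nat_finite[OF fin] by (auto simp: N_def lessThan_atLeast0)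
  then have f: "vertex_labelling G f" by (simp add: vertex_labelling_def N_def)
  define A where "A = adjacency_matrix G f + \<alpha> \<cdot>\<^sub>m degree_matrix G f"
  have A: "A \<in> carrier_mat N N" by (auto simp: A_def adjacency_matrix_def degree_matrix_def N_def)
  have Ac: "A $$ (i, j) = ?c (f i) (f j)" if "i < N" "j < N" for i j
    using that fb by (auto simp: A_def adjacency_matrix_def degree_matrix_def N_def graph_matrix_def
        bij_betw_def inj_on_eq_iff)
  have mult: "(A *\<^sub>v v) $ i = (\<Sum>j<N. ?c (f i) (f j) * v $ j)" if "i < N" "v \<in> carrier_vec N" for i v
    using that A Ac by (auto simp: scalar_prod_def lessThan_atLeast0 intro!: sum.cong)
  have reindex: "(\<Sum>w\<in>pverts G. g w) = (\<Sum>j<N. g (f j))" for g :: "'a \<Rightarrow> real"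
    using sum.reindex_bij_betw[OF fb, of g] by simp
  obtain l x where x1: "(\<Sum>i\<in>pverts G. (x i)\<^sup>2) = 1" and xl: "quad (pverts G) ?c x = l"
    and le: "\<And>y. quad (pverts G) ?c y \<le> l * (\<Sum>i\<in>pverts G. (y i)\<^sup>2)"
    using rayleigh_attained[OF fin ne, where M = ?c] by blast
  have symc: "?c u v = ?c v u" for u v using sym by (auto simp: graph_matrix_def dest: symD)
  have ev: "(\<Sum>v\<in>pverts G. ?c u v * x v) = l * x u" if "u \<in> pverts G" for u
    by (rule maximiser_is_eigenvector[OF fin symc le _ that]) (simp add: xl x1)
  have "eigenvalue A l"
  proof -
    define v where "v = vec N (\<lambda>i. x (f i))"
    have "v \<in> carrier_vec N" by (simp add: v_def)
    moreover have "v \<noteq> 0\<^sub>v N"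
    proof
      assume "v = 0\<^sub>v N"
      then have "x (f i) = 0" if "i < N" for i using that by (metis v_def index_vec index_zero_vec(1))
      then show False using x1 by (simp add: reindex)
    qed
    moreover have "A *\<^sub>v v = l \<cdot>\<^sub>v v"
    proof (rule eq_vecI)
      fix i assume "i < dim_vec (l \<cdot>\<^sub>v v)"
      then have i: "i < N" by (simp add: v_def)
      then have "f i \<in> pverts G" using fb by (auto simp: bij_betw_def)
      then show "(A *\<^sub>v v) $ i = (l \<cdot>\<^sub>v v) $ i"
        using ev[of "f i"] i mult[OF i, of v] by (simp add: reindex v_def)
    qed (use A in \<open>auto simp: v_def\<close>)
    ultimately show ?thesis using A by (auto simp: eigenvalue_def eigenvector_def)
  qed
  moreover have "l' \<le> l" if l': "eigenvalue A l'" for l'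
  proof -
    obtain v where v: "v \<in> carrier_vec N" "v \<noteq> 0\<^sub>v N" "A *\<^sub>v v = l' \<cdot>\<^sub>v v"
      using l' A by (auto simp: eigenvalue_def eigenvector_def)
    define y where "y = (\<lambda>w. v $ (the_inv_into {..<N} f w))"
    have y: "y (f i) = v $ i" if "i < N" for i
      using that fb by (simp add: y_def the_inv_into_f_f bij_betw_def)
    have eq: "(\<Sum>j<N. ?c (f i) (f j) * y (f j)) = l' * y (f i)" if "i < N" for i
      using mult[OF that v(1)] v(1,3) that by (simp add: y)
    have "quad (pverts G) ?c y = (\<Sum>i<N. y (f i) * (\<Sum>j<N. ?c (f i) (f j) * y (f j)))"
      unfolding quad_def reindex by (simp add: sum_distrib_left mult_ac)
    also have "\<dots> = (\<Sum>i<N. y (f i) * (l' * y (f i)))" by (intro sum.cong) (simp_all add: eq)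
    also have "\<dots> = l' * (\<Sum>i<N. (y (f i))\<^sup>2)"
      by (simp add: sum_distrib_left power2_eq_square mult_ac)
    finally have q: "quad (pverts G) ?c y = l' * (\<Sum>i\<in>pverts G. (y i)\<^sup>2)" by (simp add: reindex)
    obtain i where i: "i < N" "v $ i \<noteq> 0" using v(1,2) by (metis carrier_vecD eq_vecI index_zero_vec(1,2))
    then have "0 < (\<Sum>i<N. (y (f i))\<^sup>2)"
      by (intro sum_pos2[of _ i]) (simp_all add: y[OF i(1)])
    then show ?thesis using le[of y] q by (simp add: reindex)
  qed
  ultimately have "Max (spectrum A) = l"
    using card_finite_spectrum(1)[OF A] by (intro Max_eqI) (auto simp: spectrum_def)
  then have "Theta G \<alpha> = l" using Theta_eq_Max_spectrum[OF f] by (simp add: A_def)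
  then show ?thesis using that[of x] x1 xl le by simp
qed

text \<open>
  The quadratic form of $A(G) + \<alpha> D(G)$ as a sum over the edges: each edge contributes its two entries
  of \<open>A\<close> and one unit to each of the two degrees.
\<close>
definition edge_form :: "real \<Rightarrow> 'a rel \<Rightarrow> ('a \<Rightarrow> real) \<Rightarrow> real" where
  "edge_form \<alpha> R x = (\<Sum>(u, v)\<in>R. \<alpha> * (x u)\<^sup>2 + 2 * x u * x v + \<alpha> * (x v)\<^sup>2)"

lemma quad_graph_matrix_bip_graph:
  assumes fin: "finite X" "finite Y" and disj: "X \<inter> Y = {}" and R: "R \<subseteq> X \<times> Y"
  shows "quad (X \<union> Y) (graph_matrix (bip_graph X Y R) \<alpha>) x = edge_form \<alpha> R x"
proof -
  define W where "W = X \<union> Y"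
  define P where "P = R \<union> R\<inverse>"
  have finW: "finite W" using fin by (simp add: W_def)
  have PW: "P \<subseteq> W \<times> W" using R by (auto simp: P_def W_def)
  have finR: "finite R" using R fin by (meson finite_SigmaI finite_subset)
  have deg: "out_degree (with_proj (bip_graph X Y R)) u = (\<Sum>v\<in>W. if (u, v) \<in> P then 1 else 0)" for u
  proof -
    have "out_arcs (with_proj (bip_graph X Y R)) u = Pair u ` {v \<in> W. (u, v) \<in> P}"
      using PW by (auto simp: out_arcs_def P_def[symmetric])
    then show ?thesis using finW
      by (simp add: out_degree_def card_image inj_on_def flip: sum.inter_filter)
  qed
  have "quad W (graph_matrix (bip_graph X Y R) \<alpha>) x =
      (\<Sum>u\<in>W. \<Sum>v\<in>W. (if (u, v) \<in> P then x u * x v else 0) +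
         (if v = u then \<alpha> * (x u)\<^sup>2 * real (out_degree (with_proj (bip_graph X Y R)) u) else 0))"
    unfolding quad_def
    by (intro sum.cong) (auto simp: graph_matrix_def P_def power2_eq_square algebra_simps)
  also have "\<dots> = (\<Sum>u\<in>W. \<Sum>v\<in>W. (if (u, v) \<in> P then x u * x v + \<alpha> * (x u)\<^sup>2 else 0))"
  proof (rule sum.cong[OF refl])
    fix u assume u: "u \<in> W"
    have "\<alpha> * (x u)\<^sup>2 * real (out_degree (with_proj (bip_graph X Y R)) u) =
        (\<Sum>v\<in>W. if (u, v) \<in> P then \<alpha> * (x u)\<^sup>2 else 0)"
      unfolding deg by (simp add: sum_distrib_left if_distrib cong: if_cong)
    then have "(\<Sum>v\<in>W. (if (u, v) \<in> P then x u * x v else 0) +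
         (if v = u then \<alpha> * (x u)\<^sup>2 * real (out_degree (with_proj (bip_graph X Y R)) u) else 0)) =
         (\<Sum>v\<in>W. (if (u, v) \<in> P then x u * x v else 0)) + (\<Sum>v\<in>W. if (u, v) \<in> P then \<alpha> * (x u)\<^sup>2 else 0)"
      using u finW by (simp add: sum.distrib)
    also have "\<dots> = (\<Sum>v\<in>W. (if (u, v) \<in> P then x u * x v + \<alpha> * (x u)\<^sup>2 else 0))"
      by (subst sum.distrib[symmetric], intro sum.cong) auto
    finally show "(\<Sum>v\<in>W. (if (u, v) \<in> P then x u * x v else 0) +
         (if v = u then \<alpha> * (x u)\<^sup>2 * real (out_degree (with_proj (bip_graph X Y R)) u) else 0)) =
         (\<Sum>v\<in>W. (if (u, v) \<in> P then x u * x v + \<alpha> * (x u)\<^sup>2 else 0))" .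
  qed
  also have "\<dots> = (\<Sum>p\<in>W \<times> W. if p \<in> P then x (fst p) * x (snd p) + \<alpha> * (x (fst p))\<^sup>2 else 0)"
    by (simp add: sum.cartesian_product case_prod_unfold)
  also have "\<dots> = (\<Sum>p\<in>P. x (fst p) * x (snd p) + \<alpha> * (x (fst p))\<^sup>2)"
    using finW PW by (simp add: sum.inter_restrict[symmetric] Int_absorb1)
  also have "\<dots> = (\<Sum>p\<in>R. x (fst p) * x (snd p) + \<alpha> * (x (fst p))\<^sup>2) +
      (\<Sum>p\<in>R\<inverse>. x (fst p) * x (snd p) + \<alpha> * (x (fst p))\<^sup>2)"
    unfolding P_def using finR R disj by (intro sum.union_disjoint) auto
  also have "(\<Sum>p\<in>R\<inverse>. x (fst p) * x (snd p) + \<alpha> * (x (fst p))\<^sup>2) =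
      (\<Sum>p\<in>R. x (snd p) * x (fst p) + \<alpha> * (x (snd p))\<^sup>2)"
  proof -
    have "R\<inverse> = prod.swap ` R" by force
    then show ?thesis by (simp add: sum.reindex)
  qed
  also have "(\<Sum>p\<in>R. x (fst p) * x (snd p) + \<alpha> * (x (fst p))\<^sup>2) +
      (\<Sum>p\<in>R. x (snd p) * x (fst p) + \<alpha> * (x (snd p))\<^sup>2) = edge_form \<alpha> R x"
    unfolding edge_form_def sum.distrib[symmetric]
    by (intro sum.cong) (auto simp: algebra_simps)
  finally show ?thesis by (simp only: W_def)
qed

lemma Theta_bip_graph:
  assumes fin: "finite X" "finite Y" and disj: "X \<inter> Y = {}" and R: "R \<subseteq> X \<times> Y" and ne: "X \<noteq> {}"
  shows edge_form_le_Theta: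
      "edge_form \<alpha> R y \<le> Theta (bip_graph X Y R) \<alpha> * (\<Sum>i\<in>X \<union> Y. (y i)\<^sup>2)"
    and Theta_attained:
      "\<exists>x. (\<Sum>i\<in>X \<union> Y. (x i)\<^sup>2) = 1 \<and> edge_form \<alpha> R x = Theta (bip_graph X Y R) \<alpha>"
proof -
  let ?G = "bip_graph X Y R"
  have G: "finite (pverts ?G)" "pverts ?G \<noteq> {}" using fin ne by auto
  have sym: "sym (parcs ?G)" unfolding parcs_bip_graph by (rule sym_Un_converse)
  obtain x where x: "(\<Sum>i\<in>X \<union> Y. (x i)\<^sup>2) = 1" "edge_form \<alpha> R x = Theta ?G \<alpha>"
    and le: "\<And>y. edge_form \<alpha> R y \<le> Theta ?G \<alpha> * (\<Sum>i\<in>X \<union> Y. (y i)\<^sup>2)"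
    using Theta_rayleigh[OF G sym, of \<alpha>]
    unfolding pverts_bip_graph quad_graph_matrix_bip_graph[OF fin disj R] by blast
  show "edge_form \<alpha> R y \<le> Theta ?G \<alpha> * (\<Sum>i\<in>X \<union> Y. (y i)\<^sup>2)" by (rule le)
  show "\<exists>x. (\<Sum>i\<in>X \<union> Y. (x i)\<^sup>2) = 1 \<and> edge_form \<alpha> R x = Theta ?G \<alpha>" using x by blast
qed

lemma edge_form_image:
  assumes "inj_on f (X \<union> Y)" "R \<subseteq> X \<times> Y"
  shows "edge_form \<alpha> (map_prod f f ` R) x = edge_form \<alpha> R (x \<circ> f)"
proof -
  have "inj_on (map_prod f f) ((X \<union> Y) \<times> (X \<union> Y))" using assms by (simp add: map_prod_inj_on)
  then have "inj_on (map_prod f f) R" by (rule inj_on_subset) (use assms in auto)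
  then show ?thesis by (simp add: edge_form_def sum.reindex case_prod_unfold)
qed

lemma Theta_bip_graph_image:
  assumes fin: "finite X" "finite Y" and disj: "X \<inter> Y = {}" and R: "R \<subseteq> X \<times> Y" and ne: "X \<noteq> {}"
    and inj: "inj_on f (X \<union> Y)"
  shows "Theta (bip_graph (f ` X) (f ` Y) (map_prod f f ` R)) \<alpha> = Theta (bip_graph X Y R) \<alpha>"
proof -
  let ?H = "bip_graph (f ` X) (f ` Y) (map_prod f f ` R)"
  have disj': "f ` X \<inter> f ` Y = {}" using inj disj by (auto simp: inj_on_def)
  have R': "map_prod f f ` R \<subseteq> f ` X \<times> f ` Y" using R by auto
  have fin': "finite (f ` X)" "finite (f ` Y)" and ne': "f ` X \<noteq> {}" using fin ne by auto
  obtain x where x: "(\<Sum>i\<in>X \<union> Y. (x i)\<^sup>2) = 1" "edge_form \<alpha> R x = Theta (bip_graph X Y R) \<alpha>"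
    using Theta_attained[OF fin disj R ne] by blast
  obtain z where z: "(\<Sum>i\<in>f ` X \<union> f ` Y. (z i)\<^sup>2) = 1" "edge_form \<alpha> (map_prod f f ` R) z = Theta ?H \<alpha>"
    using Theta_attained[OF fin' disj' R' ne'] by blast
  have sum: "(\<Sum>i\<in>f ` X \<union> f ` Y. (y i)\<^sup>2) = (\<Sum>i\<in>X \<union> Y. ((y \<circ> f) i)\<^sup>2)" for y :: "_ \<Rightarrow> real"
    using inj by (simp add: image_Un[symmetric] sum.reindex)
  define g where "g = x \<circ> the_inv_into (X \<union> Y) f"
  have g: "(g \<circ> f) i = x i" if "i \<in> X \<union> Y" for i
    using that inj by (simp add: g_def the_inv_into_f_f)
  have "edge_form \<alpha> R (g \<circ> f) = edge_form \<alpha> R x"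
    unfolding edge_form_def by (intro sum.cong) (use R g in auto)
  then have "Theta (bip_graph X Y R) \<alpha> \<le> Theta ?H \<alpha>"
    using edge_form_le_Theta[OF fin' disj' R' ne', of \<alpha> g] x g by (simp add: edge_form_image[OF inj R] sum)
  moreover have "Theta ?H \<alpha> \<le> Theta (bip_graph X Y R) \<alpha>"
    using z edge_form_le_Theta[OF fin disj R ne, of \<alpha> "z \<circ> f"] by (simp add: edge_form_image[OF inj R] sum)
  ultimately show ?thesis by simp
qed

section \<open>Bounds for the largest eigenvalue\<close>

text \<open>
  The bound $\<rho>(G) \<le> \sqrt{e(G)}$ for bipartite graphs: by the Cauchy-Schwarz inequality the sum of
  \<open>x u * x v\<close> over the edges is at most $\sqrt{e}$ times the square root of the sum of \<open>(x u)\<^sup>2 (x v)\<^sup>2\<close>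
  over all pairs in \<open>X \<times> Y\<close>, which factors.
\<close>
lemma edge_form_0_le:
  assumes fin: "finite X" "finite Y" and disj: "X \<inter> Y = {}" and R: "R \<subseteq> X \<times> Y"
  shows "edge_form 0 R x \<le> sqrt (card R) * (\<Sum>i\<in>X \<union> Y. (x i)\<^sup>2)"
proof -
  define a where "a = (\<Sum>i\<in>X. (x i)\<^sup>2)"
  define b where "b = (\<Sum>i\<in>Y. (x i)\<^sup>2)"
  have ab: "a \<ge> 0" "b \<ge> 0" by (auto simp: a_def b_def sum_nonneg)
  define f where "f = (\<lambda>(u, v). x u * x v)"
  have "(\<Sum>p\<in>R. f p) \<le> (\<Sum>p\<in>R. \<bar>1\<bar> * \<bar>f p\<bar>)" by (intro sum_mono) auto
  also have "\<dots> \<le> L2_set (\<lambda>p. 1) R * L2_set f R" by (rule L2_set_mult_ineq)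
  also have "L2_set (\<lambda>p. 1) R = sqrt (card R)" by (simp add: L2_set_def)
  also have "L2_set f R \<le> sqrt (a * b)"
  proof -
    have "(\<Sum>p\<in>R. (f p)\<^sup>2) \<le> (\<Sum>p\<in>X \<times> Y. (f p)\<^sup>2)"
      using R fin by (intro sum_mono2) auto
    also have "\<dots> = a * b"
      by (simp add: a_def b_def f_def sum_product sum.cartesian_product power_mult_distrib case_prod_unfold)
    finally show ?thesis by (simp add: L2_set_def)
  qed
  also have "sqrt (a * b) \<le> (a + b) / 2" by (rule arith_geo_mean_sqrt[OF ab])
  finally have "(\<Sum>p\<in>R. f p) \<le> sqrt (card R) * ((a + b) / 2)" by (simp add: mult_left_mono)
  moreover have "edge_form 0 R x = 2 * (\<Sum>p\<in>R. f p)"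
    by (simp add: edge_form_def f_def sum_distrib_left case_prod_unfold mult.assoc)
  moreover have "(\<Sum>i\<in>X \<union> Y. (x i)\<^sup>2) = a + b"
    using fin disj by (simp add: a_def b_def sum.union_disjoint)
  ultimately show ?thesis by simp
qed

text \<open>
  The left-hand side is the degree \<open>d\<close> of \<open>u\<close> plus the mean degree of its neighbours. That mean is at
  most \<open>n\<close>, and at most \<open>e / d\<close> because the edges at distinct neighbours are distinct. The second
  bound is the useful one when \<open>d \<ge> e / n\<close>, by convexity of \<open>d + e / d\<close>, and the first one otherwise.
\<close>
lemma degree_plus_mean_le:
  fixes n :: nat
  assumes fin: "finite X" "finite Y" and R: "R \<subseteq> X \<times> Y" and n: "card X \<le> n" "card Y \<le> n" "0 < n"
  shows "(\<Sum>v\<in>R `` {u}. 1 + real (card (R\<inverse> `` {v})) / real (card (R `` {u}))) \<le> n + card R / n"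
proof -
  define d where "d = card (R `` {u})"
  define e where "e = card R"
  have finR: "finite R" "finite (R `` {u})" using R fin
    by (meson finite_SigmaI finite_subset) (use R fin in \<open>auto intro: finite_subset[of _ Y]\<close>)
  define D where "D = (\<Sum>v\<in>R `` {u}. card (R\<inverse> `` {v}))"
  have "d \<le> card Y" unfolding d_def using R fin by (intro card_mono) auto
  then have dn: "d \<le> n" using n by simp
  have "D = card (SIGMA v:R `` {u}. R\<inverse> `` {v})"
    unfolding D_def using finR by (subst card_SigmaI) auto
  also have "\<dots> \<le> card (R\<inverse>)" using finR by (intro card_mono) auto
  finally have De: "D \<le> e" by (simp add: e_def)
  have "card (R\<inverse> `` {v}) \<le> n" for v
  proof -
    have "card (R\<inverse> `` {v}) \<le> card X" using R fin by (intro card_mono) auto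
    then show ?thesis using n by simp
  qed
  then have "D \<le> (\<Sum>v\<in>R `` {u}. n)" unfolding D_def by (intro sum_mono) auto
  then have Dn: "D \<le> d * n" by (simp add: d_def)
  have "real d + real D / real d \<le> real n + real e / real n"
  proof (cases "d = 0")
    case False
    show ?thesis
    proof (cases "e \<le> n * d")
      case True
      have "real d + real D / real d \<le> real d + real e / real d"
        using De by (simp add: divide_right_mono)
      also have "\<dots> \<le> real n + real e / real n"
      proof -
        have "real e * (real n - real d) \<le> (real n * real d) * (real n - real d)"
          using True dn by (intro mult_right_mono) (simp_all flip: of_nat_mult)
        then show ?thesis using False n(3) by (simp add: field_simps power2_eq_square)
      qed
      finally show ?thesis .
    next
      case False': False
      have "real D \<le> real d * real n" using Dn by (simp flip: of_nat_mult)
      then have "real D / real d \<le> real n" using False by (simp add: divide_simps mult.commute)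
      moreover have "real n * real d \<le> real e" using False' by (simp flip: of_nat_mult)
      then have "real d \<le> real e / real n" using n(3) by (simp add: field_simps)
      ultimately show ?thesis by simp
    qed
  qed simp
  moreover have "(\<Sum>v\<in>R `` {u}. 1 + real (card (R\<inverse> `` {v})) / real (card (R `` {u}))) = real d + real D / real d"
    by (simp add: sum.distrib d_def D_def flip: sum_divide_distrib)
  ultimately show ?thesis by (simp add: e_def)
qed

text \<open>
  The bound of the signless Laplacian by the largest value of degree plus mean neighbour degree, on the
  level of quadratic forms: \<open>(x u + x v)\<^sup>2 \<le> (1 + t) (x u)\<^sup>2 + (1 + 1 / t) (x v)\<^sup>2\<close> with \<open>t\<close> the ratio of the
  degrees of \<open>v\<close> and \<open>u\<close>, so that summation over the edges collects exactly that quantity at each vertex.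
\<close>
lemma edge_form_1_le:
  fixes n :: nat
  assumes fin: "finite X" "finite Y" and disj: "X \<inter> Y = {}" and R: "R \<subseteq> X \<times> Y"
    and n: "card X \<le> n" "card Y \<le> n" "0 < n"
  shows "edge_form 1 R x \<le> (n + card R / n) * (\<Sum>i\<in>X \<union> Y. (x i)\<^sup>2)"
proof -
  have finR: "finite R" "finite (R `` {u})" "finite (R\<inverse> `` {u})" for u using R fin
    by (meson finite_SigmaI finite_subset)
       (use R fin in \<open>auto intro: finite_subset[of _ Y] finite_subset[of _ X]\<close>)
  define d where "d = (\<lambda>u. real (card (R `` {u})))"
  define e where "e = (\<lambda>v. real (card (R\<inverse> `` {v})))"
  have "edge_form 1 R x \<le> (\<Sum>(u, v)\<in>R. (1 + e v / d u) * (x u)\<^sup>2 + (1 + d u / e v) * (x v)\<^sup>2)"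
    unfolding edge_form_def
  proof (rule sum_mono, clarify)
    fix u v assume uv: "(u, v) \<in> R"
    then have "0 < card (R `` {u})" "0 < card (R\<inverse> `` {v})"
      using finR by (auto simp: card_gt_0_iff simp del: Image_singleton_iff)
    then have p: "d u > 0" "e v > 0" by (auto simp: d_def e_def)
    have "0 \<le> (e v * x u - d u * x v)\<^sup>2 / (d u * e v)" using p by simp
    also have "\<dots> = e v / d u * (x u)\<^sup>2 + d u / e v * (x v)\<^sup>2 - 2 * x u * x v"
      using p by (simp add: power2_eq_square field_simps)
    finally show "1 * (x u)\<^sup>2 + 2 * x u * x v + 1 * (x v)\<^sup>2 \<le> (1 + e v / d u) * (x u)\<^sup>2 + (1 + d u / e v) * (x v)\<^sup>2"
      by (simp add: algebra_simps)
  qed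
  also have "\<dots> = (\<Sum>(u, v)\<in>R. (1 + e v / d u) * (x u)\<^sup>2) + (\<Sum>(u, v)\<in>R. (1 + d u / e v) * (x v)\<^sup>2)"
    by (simp add: case_prod_unfold sum.distrib)
  also have "(\<Sum>(u, v)\<in>R. (1 + e v / d u) * (x u)\<^sup>2) \<le> (\<Sum>u\<in>X. (n + card R / n) * (x u)\<^sup>2)"
  proof -
    have "R = (SIGMA u:X. R `` {u})" using R by auto
    then have "(\<Sum>(u, v)\<in>R. (1 + e v / d u) * (x u)\<^sup>2) = (\<Sum>u\<in>X. \<Sum>v\<in>R `` {u}. (1 + e v / d u) * (x u)\<^sup>2)"
      using fin finR by (subst sum.Sigma) auto
    also have "\<dots> = (\<Sum>u\<in>X. (\<Sum>v\<in>R `` {u}. 1 + e v / d u) * (x u)\<^sup>2)"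
      by (simp only: sum_distrib_right)
    also have "\<dots> \<le> (\<Sum>u\<in>X. (n + card R / n) * (x u)\<^sup>2)"
      unfolding d_def e_def by (intro sum_mono mult_right_mono degree_plus_mean_le[OF fin R n]) auto
    finally show ?thesis .
  qed
  also have "(\<Sum>(u, v)\<in>R. (1 + d u / e v) * (x v)\<^sup>2) \<le> (\<Sum>v\<in>Y. (n + card R / n) * (x v)\<^sup>2)"
  proof -
    have R': "R\<inverse> \<subseteq> Y \<times> X" using R by auto
    have "(\<Sum>(u, v)\<in>R. (1 + d u / e v) * (x v)\<^sup>2) = (\<Sum>(v, u)\<in>R\<inverse>. (1 + d u / e v) * (x v)\<^sup>2)"
    proof -
      have "R\<inverse> = prod.swap ` R" by force
      then show ?thesis by (simp add: sum.reindex case_prod_unfold)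
    qed
    also have "R\<inverse> = (SIGMA v:Y. R\<inverse> `` {v})" using R by auto
    then have "(\<Sum>(v, u)\<in>R\<inverse>. (1 + d u / e v) * (x v)\<^sup>2) = (\<Sum>v\<in>Y. \<Sum>u\<in>R\<inverse> `` {v}. (1 + d u / e v) * (x v)\<^sup>2)"
      using fin finR by (subst sum.Sigma) auto
    also have "\<dots> = (\<Sum>v\<in>Y. (\<Sum>u\<in>R\<inverse> `` {v}. 1 + d u / e v) * (x v)\<^sup>2)"
      by (simp only: sum_distrib_right)
    also have "\<dots> \<le> (\<Sum>v\<in>Y. (n + card R / n) * (x v)\<^sup>2)"
      unfolding d_def e_def
      using degree_plus_mean_le[OF fin(2,1) R' n(2,1,3)]
      by (intro sum_mono mult_right_mono) auto
    finally show ?thesis .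
  qed
  finally show ?thesis
    using fin disj by (simp add: sum.union_disjoint sum_distrib_left[symmetric] distrib_left)
qed

lemma Theta_bip_graph_le:
  fixes n :: nat
  assumes fin: "finite X" "finite Y" and disj: "X \<inter> Y = {}" and R: "R \<subseteq> X \<times> Y" and ne: "X \<noteq> {}"
    and n: "card X \<le> n" "card Y \<le> n" and \<alpha>: "0 \<le> \<alpha>" "\<alpha> \<le> 1"
  shows "Theta (bip_graph X Y R) \<alpha> \<le> \<alpha> * (n + card R / n) + (1 - \<alpha>) * sqrt (card R)"
proof -
  have "0 < card X" using fin ne by (simp add: card_gt_0_iff)
  then have n0: "0 < n" using n by simp
  obtain x where x: "(\<Sum>i\<in>X \<union> Y. (x i)\<^sup>2) = 1" "edge_form \<alpha> R x = Theta (bip_graph X Y R) \<alpha>"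
    using Theta_attained[OF fin disj R ne] by blast
  have "edge_form \<alpha> R x = \<alpha> * edge_form 1 R x + (1 - \<alpha>) * edge_form 0 R x"
    unfolding edge_form_def sum_distrib_left sum.distrib[symmetric]
    by (intro sum.cong) (auto simp: algebra_simps)
  also have "\<dots> \<le> \<alpha> * (n + card R / n) + (1 - \<alpha>) * sqrt (card R)"
    using edge_form_1_le[OF fin disj R n n0, of x] edge_form_0_le[OF fin disj R, of x] \<alpha> x
    by (intro add_mono mult_left_mono) auto
  finally show ?thesis using x by simp
qed

lemma edge_form_mono:
  assumes "Q \<subseteq> R" "finite R" "\<And>w. 0 \<le> x w" "0 \<le> \<alpha>"
  shows "edge_form \<alpha> Q x \<le> edge_form \<alpha> R x"
  unfolding edge_form_def using assms by (intro sum_mono2) auto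

text \<open>
  The test vectors are the Perron vectors of the complete bipartite graph on \<open>X\<close> and \<open>B\<close>, extended by
  zero; nonnegativity makes all remaining edges harmless. They are constant on the two sides, with values
  \<open>\<surd>m, \<surd>n\<close> for the adjacency matrix and \<open>m, n\<close> for the signless Laplacian.
\<close>
lemma Theta_almost_complete_ge:
  fixes n m :: nat
  assumes fin: "finite X" "finite Y" and disj: "X \<inter> Y = {}" and R: "R \<subseteq> X \<times> Y"
    and B: "B \<subseteq> Y" and n: "card X = n" "card B = m" "0 < n" "0 < m"
    and sub: "X \<times> B - {p} \<subseteq> R"
  shows "(real n * m - 1) / sqrt (real n * m) \<le> Theta (bip_graph X Y R) 0"
    and "(real n * m - 1) * (n + m) / (real n * m) \<le> Theta (bip_graph X Y R) 1"
proof -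
  have ne: "X \<noteq> {}" using n by auto
  have finR: "finite R" using R fin by (meson finite_SigmaI finite_subset)
  have finB: "finite B" using B fin finite_subset by auto
  have nm: "0 < n * m" using n by simp
  have cQ: "real n * m - 1 \<le> card (X \<times> B - {p})"
  proof -
    have "card (X \<times> B) - 1 \<le> card (X \<times> B - {p})" by (simp add: card_Diff_singleton_if)
    then have "n * m - 1 \<le> card (X \<times> B - {p})" using n fin finB by (simp add: card_cartesian_product)
    then have "n * m \<le> card (X \<times> B - {p}) + 1" by simp
    then have "real (n * m) \<le> real (card (X \<times> B - {p}) + 1)" by (simp only: of_nat_le_iff)
    then show ?thesis by simp
  qed
  have bound: "(real n * m - 1) * (\<alpha> * a\<^sup>2 + 2 * a * b + \<alpha> * b\<^sup>2) \<le>
      Theta (bip_graph X Y R) \<alpha> * (n * a\<^sup>2 + m * b\<^sup>2)" if "0 \<le> a" "0 \<le> b" "0 \<le> \<alpha>" for a b \<alpha> :: real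
  proof -
    define x where "x = (\<lambda>w. if w \<in> X then a else if w \<in> B then b else 0)"
    have "(\<Sum>i\<in>X \<union> Y. (x i)\<^sup>2) = (\<Sum>i\<in>X. (x i)\<^sup>2) + (\<Sum>i\<in>Y. (x i)\<^sup>2)"
      using fin disj by (intro sum.union_disjoint) auto
    also have "(\<Sum>i\<in>X. (x i)\<^sup>2) = (\<Sum>i\<in>X. a\<^sup>2)" by (intro sum.cong) (auto simp: x_def)
    also have "(\<Sum>i\<in>Y. (x i)\<^sup>2) = (\<Sum>i\<in>B. b\<^sup>2)"
      using B disj fin by (intro sum.mono_neutral_cong_right) (auto simp: x_def)
    finally have sq: "(\<Sum>i\<in>X \<union> Y. (x i)\<^sup>2) = n * a\<^sup>2 + m * b\<^sup>2" using n by simp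
    have "edge_form \<alpha> (X \<times> B - {p}) x = (\<Sum>p\<in>X \<times> B - {p}. \<alpha> * a\<^sup>2 + 2 * a * b + \<alpha> * b\<^sup>2)"
      unfolding edge_form_def using B disj by (intro sum.cong) (auto simp: x_def disjoint_iff subset_iff)
    then have "edge_form \<alpha> (X \<times> B - {p}) x = card (X \<times> B - {p}) * (\<alpha> * a\<^sup>2 + 2 * a * b + \<alpha> * b\<^sup>2)"
      by simp
    then have "(real n * m - 1) * (\<alpha> * a\<^sup>2 + 2 * a * b + \<alpha> * b\<^sup>2) \<le> edge_form \<alpha> (X \<times> B - {p}) x"
      using cQ that by (simp add: mult_right_mono)
    also have "\<dots> \<le> edge_form \<alpha> R x"
      using that by (intro edge_form_mono[OF sub finR]) (auto simp: x_def)
    also have "\<dots> \<le> Theta (bip_graph X Y R) \<alpha> * (\<Sum>i\<in>X \<union> Y. (x i)\<^sup>2)"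
      by (rule edge_form_le_Theta[OF fin disj R ne])
    finally show ?thesis by (simp add: sq)
  qed
  define r where "r = sqrt (real n * m)"
  have r: "r > 0" "r\<^sup>2 = real n * m" using n by (auto simp: r_def)
  have "(real n * m - 1) * (2 * r) \<le> Theta (bip_graph X Y R) 0 * (2 * r\<^sup>2)"
    using bound[of "sqrt m" "sqrt n" 0] by (simp add: r(2)) (simp add: r_def real_sqrt_mult mult_ac)
  then have "(real n * m - 1) * (2 * r) \<le> (Theta (bip_graph X Y R) 0 * r) * (2 * r)"
    by (simp only: power2_eq_square mult_ac)
  then have "real n * m - 1 \<le> Theta (bip_graph X Y R) 0 * r"
    by (rule mult_right_le_imp_le) (use r in simp)
  then show "(real n * m - 1) / sqrt (real n * m) \<le> Theta (bip_graph X Y R) 0"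
    using r(1) unfolding r_def[symmetric] by (simp add: divide_le_eq)
  define c where "c = real n + m"
  have c: "c > 0" using n by (simp add: c_def)
  have "(real n * m - 1) * c * c \<le> Theta (bip_graph X Y R) 1 * (real n * m) * c"
    using bound[of m n 1] by (simp add: c_def power2_eq_square algebra_simps)
  then have "(real n * m - 1) * c \<le> Theta (bip_graph X Y R) 1 * (real n * m)"
    using c by simp
  then show "(real n * m - 1) * (n + m) / (real n * m) \<le> Theta (bip_graph X Y R) 1"
    using nm unfolding c_def by (simp add: divide_le_eq flip: of_nat_mult)
qed

text \<open>
  Passing to absolute values does not decrease the form, whose off-diagonal coefficients are
  nonnegative.
\<close>
lemma nonneg_maximiser:
  assumes fin: "finite X" "finite Y" and disj: "X \<inter> Y = {}" and R: "R \<subseteq> X \<times> Y" and ne: "X \<noteq> {}"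
  obtains x where "(\<Sum>i\<in>X \<union> Y. (x i)\<^sup>2) = 1" "edge_form \<alpha> R x = Theta (bip_graph X Y R) \<alpha>"
    "\<And>w. 0 \<le> x w"
proof -
  obtain x where x: "(\<Sum>i\<in>X \<union> Y. (x i)\<^sup>2) = 1" "edge_form \<alpha> R x = Theta (bip_graph X Y R) \<alpha>"
    using Theta_attained[OF fin disj R ne] by blast
  define y where "y = (\<lambda>w. \<bar>x w\<bar>)"
  have "edge_form \<alpha> R x \<le> edge_form \<alpha> R y"
    unfolding edge_form_def
  proof (rule sum_mono, clarify)
    fix u v
    have "x u * x v \<le> y u * y v" by (metis y_def abs_ge_self abs_mult)
    then show "\<alpha> * (x u)\<^sup>2 + 2 * x u * x v + \<alpha> * (x v)\<^sup>2 \<le> \<alpha> * (y u)\<^sup>2 + 2 * y u * y v + \<alpha> * (y v)\<^sup>2"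
      by (simp add: y_def mult.assoc)
  qed
  moreover have "(\<Sum>i\<in>X \<union> Y. (y i)\<^sup>2) = 1" using x by (simp add: y_def)
  ultimately show ?thesis using x edge_form_le_Theta[OF fin disj R ne, of \<alpha> y] by (intro that[of y]) (auto simp: y_def)
qed

lemma maximiser_row:
  assumes fin: "finite X" "finite Y" and disj: "X \<inter> Y = {}" and R: "R \<subseteq> X \<times> Y" and ne: "X \<noteq> {}"
    and x: "(\<Sum>i\<in>X \<union> Y. (x i)\<^sup>2) = 1" "edge_form \<alpha> R x = Theta (bip_graph X Y R) \<alpha>" and w: "w \<in> X \<union> Y"
  shows "(\<Sum>v\<in>(R \<union> R\<inverse>) `` {w}. x v + \<alpha> * x w) = Theta (bip_graph X Y R) \<alpha> * x w"
proof -
  let ?W = "X \<union> Y" and ?M = "graph_matrix (bip_graph X Y R) \<alpha>" and ?N = "(R \<union> R\<inverse>) `` {w}"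
  have finW: "finite ?W" using fin by simp
  have NW: "?N \<subseteq> ?W" using R by auto
  have "(\<Sum>v\<in>?W. ?M w v * x v) = Theta (bip_graph X Y R) \<alpha> * x w"
  proof (rule maximiser_is_eigenvector[OF finW _ _ _ w])
    show "?M i j = ?M j i" for i j by (auto simp: graph_matrix_def)
    show "quad ?W ?M y \<le> Theta (bip_graph X Y R) \<alpha> * (\<Sum>i\<in>?W. (y i)\<^sup>2)" for y
      unfolding quad_graph_matrix_bip_graph[OF fin disj R] by (rule edge_form_le_Theta[OF fin disj R ne])
    show "quad ?W ?M x = Theta (bip_graph X Y R) \<alpha> * (\<Sum>i\<in>?W. (x i)\<^sup>2)"
      unfolding quad_graph_matrix_bip_graph[OF fin disj R] using x by simp
  qed
  moreover have "(\<Sum>v\<in>?W. ?M w v * x v) =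
      (\<Sum>v\<in>?W. (if v \<in> ?N then x v else 0) +
        (if v = w then \<alpha> * real (out_degree (with_proj (bip_graph X Y R)) w) * x w else 0))"
    by (intro sum.cong) (auto simp: graph_matrix_def algebra_simps)
  moreover have "out_degree (with_proj (bip_graph X Y R)) w = card ?N"
  proof -
    have "out_arcs (with_proj (bip_graph X Y R)) w = Pair w ` ?N" by (auto simp: out_arcs_def)
    then show ?thesis by (simp add: out_degree_def card_image inj_on_def)
  qed
  moreover have "(\<Sum>v\<in>?W. if v \<in> ?N then x v else 0) = (\<Sum>v\<in>?N. x v)"
    using finW NW by (simp only: sum.inter_restrict[symmetric] Int_absorb1)
  ultimately show ?thesis using finW w by (simp add: sum.distrib mult_ac)
qed

text \<open>
  If equality held, \<open>x\<close> would be a maximiser for both graphs and hence satisfy both eigenvalue equations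
  with the same eigenvalue. A zero entry would spread to all neighbours in \<open>R'\<close>, and through \<open>x0\<close> and
  \<open>y0\<close> to all vertices, so \<open>x\<close> is positive. But then the equations at \<open>w\<close>, whose neighbourhood grows from
  \<open>R\<close> to \<open>R'\<close>, cannot both hold.
\<close>
lemma Theta_strict_less:
  assumes fin: "finite X" "finite Y" and disj: "X \<inter> Y = {}" and R: "R \<subseteq> X \<times> Y" and R': "R' \<subseteq> X \<times> Y"
    and \<alpha>: "0 \<le> \<alpha>"
    and x: "(\<Sum>i\<in>X \<union> Y. (x i)\<^sup>2) = 1" "edge_form \<alpha> R x = Theta (bip_graph X Y R) \<alpha>" "\<And>w. 0 \<le> x w"
    and le: "edge_form \<alpha> R x \<le> edge_form \<alpha> R' x"
    and x0: "x0 \<in> X" "{x0} \<times> Y \<subseteq> R'" and y0: "y0 \<in> Y" "X \<times> {y0} \<subseteq> R'"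
    and w: "w \<in> X" "R `` {w} \<subset> R' `` {w}"
  shows "Theta (bip_graph X Y R) \<alpha> < Theta (bip_graph X Y R') \<alpha>"
proof (rule ccontr)
  assume not_less: "\<not> Theta (bip_graph X Y R) \<alpha> < Theta (bip_graph X Y R') \<alpha>"
  have ne: "X \<noteq> {}" using w(1) by auto
  have "edge_form \<alpha> R' x \<le> Theta (bip_graph X Y R') \<alpha> * (\<Sum>i\<in>X \<union> Y. (x i)\<^sup>2)"
    by (rule edge_form_le_Theta[OF fin disj R' ne])
  then have eq: "Theta (bip_graph X Y R') \<alpha> = Theta (bip_graph X Y R) \<alpha>"
    and x': "edge_form \<alpha> R' x = Theta (bip_graph X Y R') \<alpha>"
    using not_less x le by auto
  note row = maximiser_row[OF fin disj R ne x(1,2)] and row' = maximiser_row[OF fin disj R' ne x(1) x']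
  have finN: "finite ((R' \<union> R'\<inverse>) `` {a})" for a
    by (rule finite_subset[of _ "X \<union> Y"]) (use R' fin in auto)
  have zero: "x b = 0" if "a \<in> X \<union> Y" "x a = 0" "b \<in> (R' \<union> R'\<inverse>) `` {a}" for a b
  proof -
    have "(\<Sum>v\<in>(R' \<union> R'\<inverse>) `` {a}. x v) = 0" using row'[OF that(1)] that(2) by simp
    then show ?thesis using x(3) finN that(3) by (simp add: sum_nonneg_eq_0_iff)
  qed
  have pos: "0 < x a" if "a \<in> X \<union> Y" for a
  proof (rule ccontr)
    assume "\<not> 0 < x a"
    then have "x a = 0" using x(3)[of a] by simp
    then have "x y0 = 0 \<or> x x0 = 0" using that zero[of a y0] zero[of a x0] x0 y0 by auto
    then have "x y0 = 0" using zero[of x0 y0] x0 y0 by auto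
    then have "x b = 0" if "b \<in> X" for b using zero[of y0 b] y0 that by auto
    moreover from this have "x b = 0" if "b \<in> Y" for b using zero[of x0 b] x0 that by auto
    ultimately have "x b = 0" if "b \<in> X \<union> Y" for b using that by auto
    then show False using x(1) by simp
  qed
  have N: "(R \<union> R\<inverse>) `` {w} = R `` {w}" "(R' \<union> R'\<inverse>) `` {w} = R' `` {w}" using w R R' disj by auto
  obtain b where b: "b \<in> R' `` {w} - R `` {w}" using w(2) by auto
  have "(\<Sum>v\<in>R `` {w}. x v + \<alpha> * x w) < (\<Sum>v\<in>R' `` {w}. x v + \<alpha> * x w)"
  proof (rule sum_strict_mono2[OF _ _ b])
    show "finite (R' `` {w})" using finN[of w] N by simp
    have "b \<in> X \<union> Y" using b R' by auto
    then show "0 < x b + \<alpha> * x w" using pos[of b] x(3) \<alpha> by (simp add: add_pos_nonneg)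
  qed (use w x(3) \<alpha> in auto)
  then show False using row[of w] row'[of w] w N eq by simp
qed

section \<open>Comparison with the extremal graphs\<close>

text \<open>
  Moving edges to an endpoint of larger weight does not decrease the form.
\<close>
lemma edge_form_shift:
  assumes fin: "finite C" "finite B" and "C \<inter> {a} \<times> B = {}" "C \<inter> {a'} \<times> B = {}"
    and f: "f a \<le> f a'" "\<And>w. 0 \<le> f w" and \<alpha>: "0 \<le> \<alpha>"
  shows "edge_form \<alpha> (C \<union> {a} \<times> B) f \<le> edge_form \<alpha> (C \<union> {a'} \<times> B) f"
proof -
  have row: "edge_form \<alpha> ({c} \<times> B) f = (\<Sum>b\<in>B. \<alpha> * (f c)\<^sup>2 + 2 * f c * f b + \<alpha> * (f b)\<^sup>2)" for c
  proof -
    have "{c} \<times> B = Pair c ` B" by auto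
    then show ?thesis by (simp add: edge_form_def sum.reindex inj_on_def)
  qed
  have "edge_form \<alpha> ({a} \<times> B) f \<le> edge_form \<alpha> ({a'} \<times> B) f"
    unfolding row using f \<alpha>
    by (intro sum_mono add_mono mult_left_mono mult_right_mono power_mono) auto
  moreover have "edge_form \<alpha> (C \<union> {c} \<times> B) f = edge_form \<alpha> C f + edge_form \<alpha> ({c} \<times> B) f"
    if "C \<inter> {c} \<times> B = {}" for c
    unfolding edge_form_def using fin that by (intro sum.union_disjoint) auto
  ultimately show ?thesis using assms(3,4) by simp
qed

lemma map_prod_image_Diff:
  assumes "inj_on f (X \<union> Y)" "A \<subseteq> X \<times> Y" "B \<subseteq> X \<times> Y"
  shows "map_prod f f ` (A - B) = map_prod f f ` A - map_prod f f ` B"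
proof -
  have "inj_on (map_prod f f) ((X \<union> Y) \<times> (X \<union> Y))" using assms by (simp add: map_prod_inj_on)
  then show ?thesis by (rule inj_on_image_set_diff) (use assms in auto)
qed

lemma map_prod_image_Times: "map_prod f f ` (A \<times> B) = f ` A \<times> f ` B"
  by (auto simp: image_iff)

lemma Z_graph_relabelled:
  assumes fin: "finite X" "finite Y" and disj: "X \<inter> Y = {}" and cX: "card X = n" and cY: "card Y = a + b"
    and X1: "X1 \<subseteq> X" "card X1 = n - k" "x \<in> X1" and Y1: "Y1 \<subseteq> Y" "card Y1 = b" "y \<in> Y" "y \<notin> Y1"
  shows embeds_Z_graph: "R \<subseteq> X \<times> Y - X1 \<times> Y1 \<Longrightarrow> embeds (bip_graph X Y R) (Z_graph n k a b)"
    and iso_Z_graph: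
      "digraph_iso (with_proj (bip_graph X Y (X \<times> Y - X1 \<times> Y1))) (with_proj (Z_graph n k a b))"
    and iso_Z0_graph:
      "digraph_iso (with_proj (bip_graph X Y (X \<times> Y - X1 \<times> Y1 - {(x, y)}))) (with_proj (Z0_graph n k a b))"
    and Theta_Z0_graph:
      "Theta (bip_graph X Y (X \<times> Y - X1 \<times> Y1 - {(x, y)})) \<alpha> = Theta (Z0_graph n k a b) \<alpha>"
proof -
  obtain f :: "'a \<Rightarrow> nat + nat" where inj: "inj_on f (X \<union> Y)" and f: "f ` X = Inl ` {..<n}"
    "f ` Y = Inr ` {..<a + b}" "f ` X1 = Inl ` {..<n - k}" "f ` Y1 = Inr ` {..<b}" "f x = Inl 0" "f y = Inr b"
    by (rule relabelling[OF fin disj cX cY X1 Y1])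
  have XY1: "X1 \<times> Y1 \<subseteq> X \<times> Y" using X1 Y1 by auto
  have xy: "{(x, y)} \<subseteq> X \<times> Y" "X \<times> Y - X1 \<times> Y1 \<subseteq> X \<times> Y" using X1 Y1 by auto
  have Z: "map_prod f f ` (X \<times> Y - X1 \<times> Y1) =
      Inl ` {..<n} \<times> Inr ` {..<a + b} - Inl ` {..<n - k} \<times> Inr ` {..<b}"
    unfolding map_prod_image_Diff[OF inj order_refl XY1] map_prod_image_Times f ..
  have Z0: "map_prod f f ` (X \<times> Y - X1 \<times> Y1 - {(x, y)}) =
      Inl ` {..<n} \<times> Inr ` {..<a + b} - Inl ` {..<n - k} \<times> Inr ` {..<b} - {(Inl 0, Inr b)}"
    unfolding map_prod_image_Diff[OF inj xy(2,1)] Z by (simp add: f)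
  have ne: "X \<noteq> {}" using X1 by auto
  show "embeds (bip_graph X Y R) (Z_graph n k a b)" if "R \<subseteq> X \<times> Y - X1 \<times> Y1"
    using embeds_bip_graph_image[OF fin disj xy(2) that inj] unfolding Z f Z_graph_eq_bip_graph .
  show "digraph_iso (with_proj (bip_graph X Y (X \<times> Y - X1 \<times> Y1))) (with_proj (Z_graph n k a b))"
    using digraph_iso_bip_graph_image[OF fin disj xy(2) inj] unfolding Z f Z_graph_eq_bip_graph .
  have sub: "X \<times> Y - X1 \<times> Y1 - {(x, y)} \<subseteq> X \<times> Y" by auto
  show "digraph_iso (with_proj (bip_graph X Y (X \<times> Y - X1 \<times> Y1 - {(x, y)}))) (with_proj (Z0_graph n k a b))"
    using digraph_iso_bip_graph_image[OF fin disj sub inj] unfolding Z0 f Z0_graph_eq_bip_graph .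
  show "Theta (bip_graph X Y (X \<times> Y - X1 \<times> Y1 - {(x, y)})) \<alpha> = Theta (Z0_graph n k a b) \<alpha>"
    using Theta_bip_graph_image[OF fin disj sub ne inj, of \<alpha>] unfolding Z0 f Z0_graph_eq_bip_graph by simp
qed

text \<open>
  Let \<open>(x, y)\<close> be an edge of \<open>Z\<close> missing from \<open>R\<close>; then \<open>y\<close> lies outside \<open>Y1\<close>, as the vertices of \<open>Y1\<close>
  have all their \<open>Z\<close>-neighbours. If \<open>x\<close> is in \<open>X1\<close>, then \<open>R\<close> is a proper subgraph of the copy \<open>Z - xy\<close> of
  \<open>Z\<^sup>0\<close>. Otherwise compare the weights of \<open>x\<close> and of some \<open>z\<close> in \<open>X1\<close> in a nonnegative maximiser \<open>f\<close> for
  \<open>R\<close>. In \<open>Z - xy\<close> the vertex \<open>x\<close> lacks only \<open>y\<close>, while \<open>z\<close> lacks exactly \<open>Y1\<close>. If \<open>f z \<le> f x\<close>, move the edge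
  \<open>zy\<close> to \<open>xy\<close>; if \<open>f x \<le> f z\<close>, move the edges from \<open>x\<close> to \<open>Y1\<close> over to \<open>z\<close>, so that \<open>x\<close> takes the place
  of \<open>z\<close> in \<open>X1\<close>. Both moves produce a copy of \<open>Z\<^sup>0\<close> and do not decrease the form.
\<close>
lemma Theta_less_Theta_Z0_graph:
  assumes fin: "finite X" "finite Y" and disj: "X \<inter> Y = {}" and cX: "card X = n" and cY: "card Y = a + b"
    and ab: "2 \<le> a" "1 \<le> b" and k: "1 \<le> k" "k < n"
    and X1: "X1 \<subseteq> X" "card X1 = n - k" and Y1: "Y1 \<subseteq> Y" "card Y1 = b"
    and R: "R \<subset> X \<times> Y - X1 \<times> Y1" and full: "\<And>v. v \<in> Y1 \<Longrightarrow> R\<inverse> `` {v} = X - X1"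
    and notiso: "\<not> digraph_iso (with_proj (bip_graph X Y R)) (with_proj (Z0_graph n k a b))"
    and \<alpha>: "0 \<le> \<alpha>"
  shows "Theta (bip_graph X Y R) \<alpha> < Theta (Z0_graph n k a b) \<alpha>"
proof -
  obtain x y where xy: "x \<in> X" "y \<in> Y" "(x, y) \<notin> X1 \<times> Y1" "(x, y) \<notin> R" using R by auto
  have yY1: "y \<notin> Y1"
  proof
    assume "y \<in> Y1"
    then have "x \<in> R\<inverse> `` {y}" using xy full by auto
    then show False using xy by auto
  qed
  have RXY: "R \<subseteq> X \<times> Y" and ne: "X \<noteq> {}" using R xy by auto
  obtain f where f: "(\<Sum>i\<in>X \<union> Y. (f i)\<^sup>2) = 1" "edge_form \<alpha> R f = Theta (bip_graph X Y R) \<alpha>"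
    "\<And>w. 0 \<le> f w"
    using nonneg_maximiser[OF fin disj RXY ne, of \<alpha>] by metis
  have finX1: "finite X1" "finite Y1" using X1 Y1 fin finite_subset by auto
  have "card (Y - Y1) = a" using Y1 cY finX1 by (simp add: card_Diff_subset)
  then have "card (Y - Y1 - {y}) \<noteq> 0" using yY1 xy ab by simp
  then obtain y0 where y0: "y0 \<in> Y" "y0 \<notin> Y1" "y0 \<noteq> y" by (auto simp: card_eq_0_iff)
  have "card (X - X1) = k" using X1 cX finX1 k by (simp add: card_Diff_subset)
  then obtain x0 where x0: "x0 \<in> X" "x0 \<notin> X1" using k by (metis Diff_iff card.empty equals0I not_one_le_zero)
  have "card X1 \<noteq> 0" using X1 k by simp
  then obtain z where z: "z \<in> X1" by (auto simp: card_eq_0_iff)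
  have "Y1 \<noteq> {}" using Y1 ab by auto
  define Q where "Q = X \<times> Y - X1 \<times> Y1 - {(x, y)}"
  have RQ: "R \<subseteq> Q" using R xy by (auto simp: Q_def)
  have finQ: "finite Q" using fin by (simp add: Q_def)
  have le: "edge_form \<alpha> R f \<le> edge_form \<alpha> Q f" by (rule edge_form_mono[OF RQ finQ f(3) \<alpha>])
  note strict = Theta_strict_less[OF fin disj RXY _ \<alpha> f]
  show ?thesis
  proof (cases "x \<in> X1")
    case True
    have "R \<noteq> Q" using notiso iso_Z0_graph[OF fin disj cX cY X1 True Y1 xy(2) yY1] by (auto simp: Q_def)
    then obtain w c where wc: "(w, c) \<in> Q" "(w, c) \<notin> R" using RQ by auto
    have "Theta (bip_graph X Y R) \<alpha> < Theta (bip_graph X Y Q) \<alpha>"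
    proof (rule strict[where ?x0.0 = x0 and ?y0.0 = y0 and w = w, OF _ le])
      show "R `` {w} \<subset> Q `` {w}" using wc RQ by auto
      show "w \<in> X" using wc by (auto simp: Q_def)
      show "{x0} \<times> Y \<subseteq> Q" using x0 True by (auto simp: Q_def)
      show "X \<times> {y0} \<subseteq> Q" using y0 by (auto simp: Q_def)
    qed (use x0 y0 in \<open>auto simp: Q_def\<close>)
    then show ?thesis
      using Theta_Z0_graph[OF fin disj cX cY X1 True Y1 xy(2) yY1, of \<alpha>] by (simp add: Q_def)
  next
    case False
    then have zx: "z \<noteq> x" using z by auto
    show ?thesis
    proof (cases "f z \<le> f x")
      case True
      define R' where "R' = X \<times> Y - X1 \<times> Y1 - {(z, y)}"
      \<comment> \<open>\<open>C\<close> is the common part of \<open>Q\<close> and \<open>R'\<close>; they differ by a row at \<open>z\<close> and a row at \<open>x\<close>.\<close>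
      define C where "C = X \<times> Y - X1 \<times> Y1 - {(x, y), (z, y)}"
      have "edge_form \<alpha> (C \<union> {z} \<times> {y}) f \<le> edge_form \<alpha> (C \<union> {x} \<times> {y}) f"
        by (rule edge_form_shift[OF _ _ _ _ True f(3) \<alpha>]) (use fin in \<open>auto simp: C_def\<close>)
      moreover have "C \<union> {z} \<times> {y} = Q" "C \<union> {x} \<times> {y} = R'"
        using xy z X1 yY1 zx by (auto simp: C_def Q_def R'_def)
      ultimately have le': "edge_form \<alpha> R f \<le> edge_form \<alpha> R' f" using le by simp
      have "Theta (bip_graph X Y R) \<alpha> < Theta (bip_graph X Y R') \<alpha>"
      proof (rule strict[where ?x0.0 = x and ?y0.0 = y0 and w = x, OF _ le'])
        show rowx: "{x} \<times> Y \<subseteq> R'" using xy False zx by (auto simp: R'_def)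
        show "R `` {x} \<subset> R' `` {x}" using rowx xy(2,4) RXY by auto
        show "X \<times> {y0} \<subseteq> R'" using y0 by (auto simp: R'_def)
      qed (use xy y0 in \<open>auto simp: R'_def\<close>)
      then show ?thesis
        using Theta_Z0_graph[OF fin disj cX cY X1 z Y1 xy(2) yY1, of \<alpha>] by (simp add: R'_def)
    next
      case False': False
      define X2 where "X2 = insert x (X1 - {z})"
      define R' where "R' = X \<times> Y - X2 \<times> Y1 - {(x, y)}"
      define C where "C = X \<times> Y - insert x X1 \<times> Y1 - {(x, y)}"
      have X2: "X2 \<subseteq> X" "card X2 = n - k" "x \<in> X2"
        using X1 z False xy finX1 k by (auto simp: X2_def card_insert_if)
      have "edge_form \<alpha> (C \<union> {x} \<times> Y1) f \<le> edge_form \<alpha> (C \<union> {z} \<times> Y1) f"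
        by (rule edge_form_shift[OF _ _ _ _ _ f(3) \<alpha>])
           (use fin finX1 False' z in \<open>auto simp: C_def\<close>)
      moreover have "C \<union> {x} \<times> Y1 = Q" "C \<union> {z} \<times> Y1 = R'"
        using xy z X1 Y1 yY1 zx False by (auto simp: C_def Q_def R'_def X2_def)
      ultimately have le': "edge_form \<alpha> R f \<le> edge_form \<alpha> R' f" using le by simp
      have "Theta (bip_graph X Y R) \<alpha> < Theta (bip_graph X Y R') \<alpha>"
      proof (rule strict[where ?x0.0 = z and ?y0.0 = y0 and w = z, OF _ le'])
        show rowz: "{z} \<times> Y \<subseteq> R'" using z X1 zx by (auto simp: R'_def X2_def)
        have "R `` {z} \<subseteq> Y - Y1" using R z by auto
        moreover have "Y \<subseteq> R' `` {z}" using rowz by auto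
        ultimately show "R `` {z} \<subset> R' `` {z}" using \<open>Y1 \<noteq> {}\<close> Y1 by auto
        show "X \<times> {y0} \<subseteq> R'" using y0 by (auto simp: R'_def)
      qed (use z X1 y0 in \<open>auto simp: R'_def\<close>)
      then show ?thesis
        using Theta_Z0_graph[OF fin disj cX cY X2 Y1 xy(2) yY1, of \<alpha>] by (simp add: R'_def)
    qed
  qed
qed

text \<open>
  With \<open>a = n + q - k - 1\<close>, the graph \<open>Z\<^sup>0\<close> contains \<open>K\<^bsub>n,a\<^esub>\<close> minus an edge, while \<open>\<Omega>\<close> belongs to the
  edge number \<open>E = n (a - 1) + c\<close> with \<open>c = (k + 1)(k + 1 - q)\<close>. For \<open>\<alpha> = 0\<close> the claim follows from
  \<open>E \<le> n a - 2\<close>, and for \<open>\<alpha> = 1\<close> from \<open>c + 1 + n / a < n\<close>; as \<open>n \<le> 2 a\<close>, both follow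
  from \<open>c + 3 < n\<close>, which the quadratic lower bound on \<open>n\<close> provides.
\<close>
lemma Omega_less_Theta_Z0_graph:
  assumes n: "4 * k * (k + 1) \<le> n" and k: "q + 1 \<le> k"
  shows "Omega n q k 0 < Theta (Z0_graph n k (n + q - k - 1) (k - q)) 0"
    and "Omega n q k 1 < Theta (Z0_graph n k (n + q - k - 1) (k - q)) 1"
proof -
  define a where "a = n + q - k - 1"
  define b where "b = k - q"
  define c where "c = (real k + 1) * (real k + 1 - real q)"
  have k1: "1 \<le> k" using k by simp
  have "1 * k \<le> k * k" using k1 by (intro mult_le_mono1)
  moreover have "4 * (k * k) + 4 * k \<le> n" using n by (simp add: algebra_simps)
  ultimately have nk: "k * k + 2 * k + 4 < n" "2 * k + 2 \<le> n"
    using k1 by linarith+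
  have ra: "real a = real n + real q - real k - 1" using nk by (simp add: a_def of_nat_diff)
  have a_half: "real n \<le> 2 * real a" using nk unfolding ra by simp
  have a0: "0 < a" using a_half nk by (cases "a = 0") auto
  have n0: "0 < n" using nk by simp
  have "c \<le> (real k + 1) * (real k + 1)" unfolding c_def using k by (intro mult_left_mono) auto
  also have "\<dots> = real (k * k + 2 * k + 4) - 3" by (simp add: algebra_simps)
  also have "\<dots> < real n - 3" using nk(1) by (simp only: diff_strict_right_mono of_nat_less_iff)
  finally have cn: "c + 3 < real n" by simp
  have c0: "0 \<le> c" unfolding c_def using k by (intro mult_nonneg_nonneg) auto
  define X :: "(nat + nat) set" where "X = Inl ` {..<n}"
  define Y :: "(nat + nat) set" where "Y = Inr ` {..<a + b}"
  define B :: "(nat + nat) set" where "B = Inr ` {b..<a + b}"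
  define R where "R = X \<times> Y - Inl ` {..<n - k} \<times> Inr ` {..<b} - {(Inl 0, Inr b)}"
  have "finite X" "finite Y" "X \<inter> Y = {}" "R \<subseteq> X \<times> Y" "B \<subseteq> Y" "card X = n" "card B = a"
    by (auto simp: X_def Y_def B_def R_def card_image)
  moreover have "X \<times> B - {(Inl 0, Inr b)} \<subseteq> R"
    by (auto simp: X_def Y_def B_def R_def)
  moreover have "Z0_graph n k a b = bip_graph X Y R"
    by (simp add: Z0_graph_eq_bip_graph X_def Y_def R_def)
  ultimately have rho: "(real n * a - 1) / sqrt (real n * a) \<le> Theta (Z0_graph n k a b) 0"
    and mu: "(real n * a - 1) * (n + a) / (real n * a) \<le> Theta (Z0_graph n k a b) 1"
    using Theta_almost_complete_ge[of X Y R B n a] n0 a0 by auto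
  define t where "t = real n * real a"
  define E where "E = real n * (real a - 1) + c"
  have Eq: "real n * (real n + real q - real k - 2) + (real k + 1) * (real k + 1 - real q) = E"
    unfolding E_def c_def ra by simp
  have t1: "1 \<le> t" unfolding t_def using n0 a0 by (simp flip: of_nat_mult) 
  have Et: "E \<le> t - 2" using cn unfolding E_def t_def by (simp add: algebra_simps)
  have "E * t \<le> (t - 2) * t" using Et t1 by (intro mult_right_mono) auto
  also have "\<dots> < (t - 1)\<^sup>2" by (simp add: power2_eq_square algebra_simps)
  finally have "sqrt (E * t) < t - 1" using t1 by (intro real_less_lsqrt) auto
  then have "sqrt E < (t - 1) / sqrt t" using t1 by (simp add: real_sqrt_mult less_divide_eq)
  moreover have "Omega n q k 0 = sqrt E" by (simp add: Omega_def Eq)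
  ultimately show "Omega n q k 0 < Theta (Z0_graph n k (n + q - k - 1) (k - q)) 0"
    using rho unfolding t_def a_def[symmetric] b_def[symmetric] by linarith
  have "1 / real a \<le> 2 / real n" using a_half a0 n0 by (simp add: field_simps)
  moreover have "(c + 3) / real n < 1" using cn n0 by simp
  then have "c / real n + 1 / real n + 2 / real n < 1" by (simp add: add_divide_distrib)
  ultimately have "c / real n + 1 / real n + 1 / real a < 1" by linarith
  moreover have "(real n * a - 1) * (n + a) / (real n * a) = real n + a - 1 / n - 1 / a"
    using n0 a0 by (simp add: field_simps)
  moreover have "Omega n q k 1 = real n + real a - 1 + c / real n"
    unfolding Omega_def c_def ra by simp
  ultimately have "Omega n q k 1 < (real n * a - 1) * (n + a) / (real n * a)" by linarith
  then show "Omega n q k 1 < Theta (Z0_graph n k (n + q - k - 1) (k - q)) 1"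
    using mu unfolding a_def[symmetric] b_def[symmetric] by linarith
qed

section \<open>Graphs that are not traceable\<close>

lemma vwalk_arcs_subset_if_successively:
  "successively (\<lambda>x y. (x, y) \<in> E) xs \<Longrightarrow> set (vwalk_arcs xs) \<subseteq> E"
  by (induction xs rule: vwalk_arcs.induct) auto

text \<open>
  After deleting \<open>S\<close>, the larger side has one vertex more than the other. Adding a new vertex \<open>None\<close> to the
  smaller side, adjacent to the whole larger side, balances the graph, and cutting a Hamiltonian cycle
  of it at \<open>None\<close> would give a spanning path. So the non-Hamiltonian case applies with \<open>p = n - q\<close> and
  \<open>s = k + 1 - q\<close>: the new vertex raises the degrees in \<open>X - S\<close> by one, which is where the lower bounds
  \<open>s\<close> and \<open>s - 1\<close> come from. Putting \<open>S\<close> back adds at most \<open>q\<close> neighbours to the \<open>k - q\<close> vertices found.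
\<close>
lemma sparse_structure_if_no_spanning_path:
  assumes fin: "finite X" "finite Y" and disj: "X \<inter> Y = {}" and cX: "card X = n" and cY: "card Y = n - 1"
    and R: "R \<subseteq> X \<times> Y" and q: "q + 1 \<le> k"
    and degX: "\<And>u. u \<in> X \<Longrightarrow> k \<le> card (R `` {u})" and degY: "\<And>v. v \<in> Y \<Longrightarrow> k \<le> card (R\<inverse> `` {v})"
    and S: "card (S \<inter> X) = q" "card (S \<inter> Y) = q"
    and nopath: "\<not> has_spanning_path (with_proj (bip_graph X Y R) \<restriction> (X \<union> Y - S))"
    and few: "card (X \<times> Y - R) < (k + 1 - q) * (n - k - 1)"
  obtains X1 Y1 where "X1 \<subseteq> X" "card X1 = n - k" "Y1 \<subseteq> Y" "card Y1 = k - q" "R \<inter> X1 \<times> Y1 = {}"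
proof -
  define p where "p = n - q"
  define s where "s = k + 1 - q"
  have n: "k + 2 \<le> n"
  proof (rule ccontr)
    assume "\<not> k + 2 \<le> n"
    then have "n - k - 1 = 0" by simp
    with few show False by simp
  qed
  define X' where "X' = X - S"
  define Y' where "Y' = Y - S"
  define R' where "R' = R \<inter> X' \<times> Y'"
  define U where "U = Some ` X'"
  define V where "V = insert None (Some ` Y')"
  define Q where "Q = map_prod Some Some ` R' \<union> U \<times> {None}"
  have card_Diff_S: "card (A - S) = card A - card (S \<inter> A)" if "finite A" for A :: "'a set"
    using that by (metis Diff_Int_distrib2 Int_commute card_Diff_subset_Int finite_Int)
  have cX': "card X' = p" using card_Diff_S[OF fin(1)] cX S by (simp add: X'_def p_def)
  have cY': "card Y' = p - 1" using card_Diff_S[OF fin(2)] cY S by (simp add: Y'_def p_def)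
  have p: "s + (n - k - 1) = p" "1 \<le> p" using q n by (auto simp: p_def s_def)
  have finUV: "finite U" "finite V" and disjUV: "U \<inter> V = {}" using fin by (auto simp: U_def V_def X'_def Y'_def disj)
      (use disj in auto)
  have cU: "card U = p" using cX' by (simp add: U_def card_image)
  have cV: "card V = p"
  proof -
    have "finite (Some ` Y')" "None \<notin> Some ` Y'" using fin by (auto simp: Y'_def)
    then show ?thesis using cY' p by (simp add: V_def card_image)
  qed
  have QUV: "Q \<subseteq> U \<times> V" by (auto simp: Q_def R'_def U_def V_def)
  have nonham: "\<not> hamiltonian_cycle (Q \<union> Q\<inverse>) (U \<union> V) xs" for xs
  proof
    assume "hamiltonian_cycle (Q \<union> Q\<inverse>) (U \<union> V) xs"
    then obtain ys where ys: "hamiltonian_cycle (Q \<union> Q\<inverse>) (U \<union> V) (None # ys)"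
      using hamiltonian_cycle_start[of "Q \<union> Q\<inverse>" "U \<union> V" xs None] by (auto simp: V_def)
    define zs where "zs = map the ys"
    have None: "None \<notin> set ys" and d: "distinct ys" and set_ys: "insert None (set ys) = U \<union> V"
      using ys by (auto simp: hamiltonian_cycle_def)
    have "set ys = U \<union> V - {None}" using None set_ys by auto
    also have "\<dots> = Some ` (X' \<union> Y')" by (auto simp: U_def V_def)
    finally have set_ys: "set ys = Some ` (X' \<union> Y')" .
    have "map (\<lambda>w. Some (the w)) ys = ys"
    proof (rule map_idI)
      fix w assume "w \<in> set ys"
      then show "Some (the w) = w" using None by (metis option.collapse)
    qed
    then have ys_zs: "ys = map Some zs" by (simp add: zs_def comp_def)
    have set_zs: "set zs = X' \<union> Y'" by (simp add: zs_def set_ys image_image)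
    have "X' \<noteq> {}" using cX' p by auto
    then have ne: "zs \<noteq> []" using set_zs by auto
    have "successively (\<lambda>x y. (x, y) \<in> Q \<union> Q\<inverse>) (map Some zs)"
      using ys ne unfolding ys_zs by (auto simp: hamiltonian_cycle_def successively_Cons)
    then have "successively (\<lambda>x y. (Some x, Some y) \<in> Q \<union> Q\<inverse>) zs" by (simp only: successively_map)
    then have "successively (\<lambda>x y. (x, y) \<in> R' \<union> R'\<inverse>) zs"
      by (rule successively_mono) (auto simp: Q_def)
    then have arcs: "set (vwalk_arcs zs) \<subseteq> R' \<union> R'\<inverse>" by (rule vwalk_arcs_subset_if_successively)
    let ?H = "with_proj (bip_graph X Y R) \<restriction> (X \<union> Y - S)"
    have "R' \<union> R'\<inverse> \<subseteq> arcs_ends ?H"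
      by (force simp: arcs_ends_def arc_to_ends_def R'_def X'_def Y'_def)
    then have "vwalk zs ?H"
      using arcs ne set_zs by (auto simp: vwalk_def X'_def Y'_def)
    moreover have "distinct zs" using d unfolding ys_zs by (simp add: distinct_map)
    ultimately have "has_spanning_path ?H"
      using set_zs by (auto simp: has_spanning_path_def vpath_def X'_def Y'_def)
    then show False using nopath by simp
  qed
  have dU: "s \<le> card (Q `` {u})" if "u \<in> U" for u
  proof -
    obtain a where a: "u = Some a" "a \<in> X'" using \<open>u \<in> U\<close> by (auto simp: U_def)
    have eq: "Q `` {u} = insert None (Some ` (R `` {a} - S))"
      using a R by (auto simp: Q_def R'_def U_def X'_def Y'_def)
    have fa: "finite (R `` {a})" using R fin by (auto intro: finite_subset[of _ Y])
    have "card (S \<inter> R `` {a}) \<le> card (S \<inter> Y)" using R fin by (intro card_mono) auto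
    then have "k - q \<le> card (R `` {a} - S)"
      using card_Diff_S[OF fa] degX[of a] a S by (simp add: X'_def)
    moreover have "card (Q `` {u}) = Suc (card (R `` {a} - S))"
      unfolding eq using fa by (subst card_insert_disjoint) (auto simp: card_image)
    ultimately show ?thesis using q by (simp add: s_def)
  qed
  have dV: "s - 1 \<le> card (Q\<inverse> `` {v})" if "v \<in> V" for v
  proof (cases v)
    case None
    have "Q\<inverse> `` {None} = U" by (auto simp: Q_def)
    then show ?thesis using None cU p by simp
  next
    case (Some b)
    then have b: "b \<in> Y'" using that by (auto simp: V_def)
    have eq: "Q\<inverse> `` {v} = Some ` (R\<inverse> `` {b} - S)"
      using b R Some by (auto simp: Q_def R'_def U_def X'_def Y'_def)
    have fb: "finite (R\<inverse> `` {b})" using R fin by (auto intro: finite_subset[of _ X])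
    have "card (S \<inter> R\<inverse> `` {b}) \<le> card (S \<inter> X)" using R fin by (intro card_mono) auto
    then have "k - q \<le> card (R\<inverse> `` {b} - S)"
      using card_Diff_S[OF fb] degY[of b] b S by (simp add: Y'_def)
    then show ?thesis unfolding eq by (simp add: s_def card_image)
  qed
  have "U \<times> V - Q \<subseteq> map_prod Some Some ` (X \<times> Y - R)"
    by (auto simp: U_def V_def Q_def R'_def X'_def Y'_def)
  then have "card (U \<times> V - Q) \<le> card (map_prod Some Some ` (X \<times> Y - R))"
    using fin by (intro card_mono) auto
  also have "\<dots> \<le> card (X \<times> Y - R)" using fin by (intro card_image_le) auto
  also have "card (X \<times> Y - R) < s * (n - k - 1)" using few by (simp only: s_def)
  also have "n - k - 1 = p - s" using p(1) by linarith
  finally have fewQ: "card (U \<times> V - Q) < s * (p - s)" .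
  obtain B where B: "B \<subseteq> V" "card B = s - 1" "card (Q\<inverse> `` B) \<le> s - 1"
    using nonhamiltonian_sparse_complement[OF finUV disjUV cU cV QUV nonham dU dV fewQ] .
  have finQB: "finite (Q\<inverse> `` B)" using QUV finUV by (auto intro: finite_subset[of _ U])
  \<comment> \<open>The new vertex has \<open>p\<close> neighbours, more than \<open>B\<close> has altogether.\<close>
  have "None \<notin> B"
  proof
    assume "None \<in> B"
    then have "U \<subseteq> Q\<inverse> `` B" by (auto simp: Q_def)
    then have "card U \<le> card (Q\<inverse> `` B)" by (rule card_mono[OF finQB])
    then have "p \<le> s - 1" using cU B(3) by linarith
    then show False using p n by (simp add: s_def p_def)
  qed
  define Y1 where "Y1 = {b. Some b \<in> B}"
  have BY1: "B = Some ` Y1"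
  proof (intro subset_antisym subsetI)
    fix w assume w: "w \<in> B"
    then obtain c where "w = Some c" using \<open>None \<notin> B\<close> by (metis option.exhaust)
    then show "w \<in> Some ` Y1" using w by (simp add: Y1_def)
  qed (auto simp: Y1_def)
  have Y1: "Y1 \<subseteq> Y'" using B by (auto simp: BY1 V_def)
  have cY1: "card Y1 = k - q" using B(2) by (simp add: BY1 card_image s_def)
  define N where "N = R\<inverse> `` Y1"
  have NX: "N \<subseteq> X" using R by (auto simp: N_def)
  have "N \<subseteq> (S \<inter> X) \<union> the ` (Q\<inverse> `` B)"
  proof
    fix a assume "a \<in> N"
    then obtain b where b: "b \<in> Y1" "(a, b) \<in> R" by (auto simp: N_def)
    show "a \<in> (S \<inter> X) \<union> the ` (Q\<inverse> `` B)"
    proof (cases "a \<in> S")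
      case False
      then have "(Some a, Some b) \<in> Q" using b Y1 R by (auto simp: Q_def R'_def X'_def)
      then have "Some a \<in> Q\<inverse> `` B" using b BY1 by auto
      then show ?thesis by force
    qed (use NX \<open>a \<in> N\<close> in auto)
  qed
  then have "card N \<le> card ((S \<inter> X) \<union> the ` (Q\<inverse> `` B))"
    using fin finQB by (intro card_mono) auto
  also have "\<dots> \<le> card (S \<inter> X) + card (the ` (Q\<inverse> `` B))" by (rule card_Un_le)
  also have "\<dots> \<le> q + (k - q)" using card_image_le[OF finQB, of the] B(3) S by (simp add: s_def)
  finally have "card N \<le> k" using q by simp
  then have "n - k \<le> card (X - N)"
    using NX fin cX by (simp add: card_Diff_subset finite_subset)
  then obtain X1 where X1: "X1 \<subseteq> X - N" "card X1 = n - k" by (meson obtain_subset_with_card_n)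
  then have "R \<inter> X1 \<times> Y1 = {}" by (auto simp: N_def)
  then show ?thesis using that[of X1 Y1] X1 Y1 cY1 by (auto simp: Y'_def)
qed

text \<open>
  \<open>\<Omega>\<close> is the upper bound on \<open>\<Theta>\<close> at the edge number \<open>E = n (n - 1) - (k + 1 - q)(n - k - 1)\<close>, and the bound
  increases with the number of edges. So \<open>\<Theta> > \<Omega>\<close> means that fewer than
  \<open>(k + 1 - q)(n - k - 1)\<close> pairs are nonadjacent.
\<close>
lemma extremal_structure_if_not_traceable:
  assumes fin: "finite X" "finite Y" and disj: "X \<inter> Y = {}" and cX: "card X = n" and cY: "card Y = n - 1"
    and R: "R \<subseteq> X \<times> Y" and q: "q + 1 \<le> k" and n: "k + 2 \<le> n"
    and degX: "\<And>u. u \<in> X \<Longrightarrow> k \<le> card (R `` {u})" and degY: "\<And>v. v \<in> Y \<Longrightarrow> k \<le> card (R\<inverse> `` {v})"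
    and nottr: "\<not> qq_traceable q (bip_graph X Y R) X Y"
    and \<alpha>: "0 \<le> \<alpha>" "\<alpha> \<le> 1" and large: "Omega n q k \<alpha> < Theta (bip_graph X Y R) \<alpha>"
  obtains X1 Y1 where "X1 \<subseteq> X" "card X1 = n - k" "Y1 \<subseteq> Y" "card Y1 = k - q" "R \<inter> X1 \<times> Y1 = {}"
proof -
  define E where "E = real n * (real n + real q - real k - 2) + (real k + 1) * (real k + 1 - real q)"
  have n0: "0 < n" using n by simp
  have ne: "X \<noteq> {}" using cX n0 by auto
  have finR: "finite R" using R fin by (meson finite_SigmaI finite_subset)
  have few: "card (X \<times> Y - R) < (k + 1 - q) * (n - k - 1)"
  proof (rule ccontr)
    assume "\<not> card (X \<times> Y - R) < (k + 1 - q) * (n - k - 1)"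
    then have "(k + 1 - q) * (n - k - 1) + card R \<le> card (X \<times> Y - R) + card R" by simp
    also have "\<dots> = card (X \<times> Y)"
      using R finR fin by (metis card_Diff_subset card_mono finite_SigmaI le_add_diff_inverse2)
    also have "\<dots> = n * (n - 1)" using cX cY by (simp add: card_cartesian_product)
    finally have "real ((k + 1 - q) * (n - k - 1) + card R) \<le> real (n * (n - 1))" by (simp only: of_nat_le_iff)
    moreover have "real (k + 1 - q) = real k + 1 - real q" "real (n - k - 1) = real n - real k - 1"
      "real (n - 1) = real n - 1"
      using q n by (simp_all add: of_nat_diff)
    ultimately have "(real k + 1 - real q) * (real n - real k - 1) + real (card R) \<le> real n * (real n - 1)"
      by (simp only: of_nat_add of_nat_mult)
    then have eE: "real (card R) \<le> E" by (simp add: E_def algebra_simps)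
    have "Theta (bip_graph X Y R) \<alpha> \<le> \<alpha> * (n + card R / n) + (1 - \<alpha>) * sqrt (card R)"
      using cX cY by (intro Theta_bip_graph_le[OF fin disj R ne _ _ \<alpha>]) auto
    also have "\<dots> \<le> \<alpha> * (n + E / n) + (1 - \<alpha>) * sqrt E"
      using eE \<alpha> n0 by (intro add_mono mult_left_mono divide_right_mono) auto
    also have "n + E / n = 2 * real n + real q - real k - 2 + (real k + 1) * (real k + 1 - real q) / real n"
      using n0 by (simp add: E_def add_divide_distrib)
    also have "\<alpha> * \<dots> + (1 - \<alpha>) * sqrt E = Omega n q k \<alpha>" by (simp add: Omega_def E_def)
    finally show False using large by simp
  qed
  obtain S where S: "card (S \<inter> X) = q" "card (S \<inter> Y) = q"
    "\<not> has_spanning_path (with_proj (bip_graph X Y R) \<restriction> (X \<union> Y - S))"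
    using nottr by (auto simp: qq_traceable_def)
  show ?thesis
    using sparse_structure_if_no_spanning_path[OF fin disj cX cY R q degX degY S few] that by metis
qed

text \<open>
  The two parts for a bipartition whose first class is the larger one. In the second part the spectral
  hypothesis exceeds \<open>\<Omega>\<close>, because \<open>Z\<^sup>0\<close> does, so the graph lies in a copy of \<open>Z\<close>; the minimum degree
  keeps all edges at \<open>Y1\<close>, and a graph other than \<open>Z\<close> and \<open>Z\<^sup>0\<close> would have a smaller \<open>\<Theta>\<close> than \<open>Z\<^sup>0\<close>.
\<close>
lemma spectral_traceability_oriented:
  fixes G :: "'a pair_pre_digraph"
  assumes G: "bipartite_graph G X Y" and cX: "card X = n" and cY: "card Y = n - 1" and n0: "0 < n"
    and deg: "k \<le> min_degree G" and q: "q + 1 \<le> k" and nottr: "\<not> qq_traceable q G X Y"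
  shows "3 * k + 4 \<le> n \<Longrightarrow> 0 \<le> \<alpha> \<Longrightarrow> \<alpha> \<le> 1 \<Longrightarrow> Omega n q k \<alpha> < Theta G \<alpha> \<Longrightarrow>
      embeds G (Z_graph n k (n + q - k - 1) (k - q))"
    and "4 * k * (k + 1) \<le> n \<Longrightarrow>
      rho (Z0_graph n k (n + q - k - 1) (k - q)) \<le> rho G \<or> mu (Z0_graph n k (n + q - k - 1) (k - q)) \<le> mu G \<Longrightarrow>
      digraph_iso (with_proj G) (with_proj (Z_graph n k (n + q - k - 1) (k - q))) \<or>
      digraph_iso (with_proj G) (with_proj (Z0_graph n k (n + q - k - 1) (k - q)))"
proof -
  define R where "R = parcs G \<inter> X \<times> Y"
  define a where "a = n + q - k - 1"
  define b where "b = k - q"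
  have GR: "G = bip_graph X Y R" unfolding R_def by (rule bipartite_graph_eq_bip_graph[OF G])
  interpret pair_graph G using G by (simp add: bipartite_graph_def)
  have fin: "finite X" "finite Y" and disj: "X \<inter> Y = {}" and R: "R \<subseteq> X \<times> Y"
    using G pair_finite_verts by (auto simp: bipartite_graph_def R_def)
  have deg': "k \<le> out_degree (with_proj G) w" if "w \<in> X \<union> Y" for w
  proof -
    have "min_degree G \<le> out_degree (with_proj G) w"
      unfolding min_degree_def using that fin by (intro Min_le) (auto simp: GR)
    then show ?thesis using deg by simp
  qed
  have degX: "k \<le> card (R `` {u})" if "u \<in> X" for u
    using deg'[of u] out_degree_bip_graph(1)[OF disj R that] that by (simp add: GR)
  have degY: "k \<le> card (R\<inverse> `` {v})" if "v \<in> Y" for v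
    using deg'[of v] out_degree_bip_graph(2)[OF disj R that] that by (simp add: GR)
  note extremal = extremal_structure_if_not_traceable[OF fin disj cX cY R q]
  have points: "\<exists>x y. x \<in> X1 \<and> y \<in> Y \<and> y \<notin> Y1"
    if "k + 2 \<le> n" "card X1 = n - k" "Y1 \<subseteq> Y" "card Y1 = b" for X1 Y1 :: "'a set"
  proof -
    have "card X1 \<noteq> 0" using that by simp
    then have "X1 \<noteq> {}" by auto
    moreover have "Y1 \<noteq> Y" using that cY q by (auto simp: b_def)
    ultimately show ?thesis using that(3) by auto
  qed
  have cYab: "card Y = a + b" if "k + 2 \<le> n" using that cY q by (simp add: a_def b_def)
  show "embeds G (Z_graph n k (n + q - k - 1) (k - q))"
    if n: "3 * k + 4 \<le> n" and \<alpha>: "0 \<le> \<alpha>" "\<alpha> \<le> 1" and large: "Omega n q k \<alpha> < Theta G \<alpha>"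
  proof -
    have nk: "k + 2 \<le> n" using n by simp
    obtain X1 Y1 where XY1: "X1 \<subseteq> X" "card X1 = n - k" "Y1 \<subseteq> Y" "card Y1 = b" "R \<inter> X1 \<times> Y1 = {}"
      using extremal[OF nk degX degY nottr[unfolded GR] \<alpha> large[unfolded GR]] unfolding b_def by metis
    obtain x y where xy: "x \<in> X1" "y \<in> Y" "y \<notin> Y1" using points[OF nk XY1(2,3,4)] by auto
    have "R \<subseteq> X \<times> Y - X1 \<times> Y1" using XY1 R by auto
    then show ?thesis
      using embeds_Z_graph[OF fin disj cX cYab[OF nk] XY1(1,2) xy(1) XY1(3,4) xy(2,3), of R]
      by (simp add: GR a_def b_def)
  qed
  show "digraph_iso (with_proj G) (with_proj (Z_graph n k (n + q - k - 1) (k - q))) \<or>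
      digraph_iso (with_proj G) (with_proj (Z0_graph n k (n + q - k - 1) (k - q)))"
    if n: "4 * k * (k + 1) \<le> n"
      and large: "rho (Z0_graph n k (n + q - k - 1) (k - q)) \<le> rho G \<or>
        mu (Z0_graph n k (n + q - k - 1) (k - q)) \<le> mu G"
  proof (rule ccontr)
    assume "\<not> ?thesis"
    then have notZ: "\<not> digraph_iso (with_proj G) (with_proj (Z_graph n k a b))"
      and notZ0: "\<not> digraph_iso (with_proj (bip_graph X Y R)) (with_proj (Z0_graph n k a b))"
      by (auto simp: a_def b_def GR)
    obtain \<alpha> :: real where \<alpha>: "\<alpha> = 0 \<or> \<alpha> = 1" and ge: "Theta (Z0_graph n k a b) \<alpha> \<le> Theta G \<alpha>"
      using large unfolding rho_def mu_def a_def b_def by blast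
    have \<alpha>01: "0 \<le> \<alpha>" "\<alpha> \<le> 1" using \<alpha> by auto
    have "4 * k * 2 \<le> 4 * k * (k + 1)" using q by (intro mult_le_mono2) simp
    then have nk: "k + 2 \<le> n" "k + 3 \<le> n" "k < n" using n q by linarith+
    have "Omega n q k \<alpha> < Theta (Z0_graph n k a b) \<alpha>"
      using \<alpha> Omega_less_Theta_Z0_graph[OF n q] unfolding a_def b_def by auto
    then have "Omega n q k \<alpha> < Theta (bip_graph X Y R) \<alpha>" using ge by (simp add: GR)
    then obtain X1 Y1 where XY1: "X1 \<subseteq> X" "card X1 = n - k" "Y1 \<subseteq> Y" "card Y1 = b" "R \<inter> X1 \<times> Y1 = {}"
      using extremal[OF nk(1) degX degY nottr[unfolded GR] \<alpha>01] unfolding b_def by metis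
    obtain x y where xy: "x \<in> X1" "y \<in> Y" "y \<notin> Y1" using points[OF nk(1) XY1(2,3,4)] by auto
    have "R \<subseteq> X \<times> Y - X1 \<times> Y1" using XY1 R by auto
    moreover have "R \<noteq> X \<times> Y - X1 \<times> Y1"
      using iso_Z_graph[OF fin disj cX cYab[OF nk(1)] XY1(1,2) xy(1) XY1(3,4) xy(2,3)] notZ
      by (auto simp: GR)
    ultimately have psub: "R \<subset> X \<times> Y - X1 \<times> Y1" by auto
    have full: "R\<inverse> `` {v} = X - X1" if "v \<in> Y1" for v
    proof (rule card_seteq)
      show "R\<inverse> `` {v} \<subseteq> X - X1" using R XY1 that by auto
      have "card (X - X1) = k"
        using XY1 fin cX nk by (simp add: card_Diff_subset finite_subset)
      then show "card (X - X1) \<le> card (R\<inverse> `` {v})" using degY[of v] that XY1 by auto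
    qed (use fin in auto)
    have "Theta (bip_graph X Y R) \<alpha> < Theta (Z0_graph n k a b) \<alpha>"
      by (rule Theta_less_Theta_Z0_graph[OF fin disj cX cYab[OF nk(1)] _ _ _ nk(3) XY1(1-4) psub full notZ0 \<alpha>01(1)])
         (use q nk in \<open>auto simp: a_def b_def\<close>)
    then show False using ge by (simp add: GR)
  qed
qed

theorem theorem1p21:
  fixes q k n :: nat and G :: "'a pair_pre_digraph" and U V :: "'a set"
  assumes "almost_balanced_bipartite G U V"
    and "card (pverts G) = 2 * n - 1"
    and "min_degree G \<ge> k"
    and "k \<ge> q + 1"
  shows "(\<forall>\<alpha>::real. n \<ge> 3 * k + 4 \<and> 0 \<le> \<alpha> \<and> \<alpha> \<le> 1 \<and> Theta G \<alpha> > Omega n q k \<alpha> \<longrightarrow>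
            \<not> embeds G (Z_graph n k (n + q - k - 1) (k - q)) \<longrightarrow> qq_traceable q G U V)
       \<and> (n \<ge> 4 * k * (k + 1) \<and>
          (rho G \<ge> rho (Z0_graph n k (n + q - k - 1) (k - q)) \<or>
           mu G \<ge> mu (Z0_graph n k (n + q - k - 1) (k - q))) \<longrightarrow>
            \<not> (digraph_iso (with_proj G) (with_proj (Z_graph n k (n + q - k - 1) (k - q))) \<or>
               digraph_iso (with_proj G) (with_proj (Z0_graph n k (n + q - k - 1) (k - q)))) \<longrightarrow>
            qq_traceable q G U V)"
proof -
  have G: "bipartite_graph G U V" and bal: "int (card U) - int (card V) \<in> {1, -1}"
    using assms(1) by (auto simp: almost_balanced_bipartite_def)
  interpret pair_graph G using G by (simp add: bipartite_graph_def)
  have "finite U" "finite V" "U \<inter> V = {}" and verts: "pverts G = U \<union> V"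
    using G pair_finite_verts by (auto simp: bipartite_graph_def)
  then have sum: "card U + card V = 2 * n - 1" using assms(2) by (simp add: card_Un_disjoint)
  have n0: "0 < n" using sum bal by (cases n) auto
  obtain X Y where XY: "bipartite_graph G X Y" "card X = n" "card Y = n - 1"
    and tr: "qq_traceable q G U V \<longleftrightarrow> qq_traceable q G X Y"
  proof (cases "int (card U) - int (card V) = 1")
    case True
    then show ?thesis using that[of U V] G sum n0 by auto
  next
    case False
    moreover have "bipartite_graph G V U" using G by (auto simp: bipartite_graph_def)
    moreover have "qq_traceable q G U V \<longleftrightarrow> qq_traceable q G V U"
      by (auto simp: qq_traceable_def)
    ultimately show ?thesis using that[of V U] bal sum n0 by auto
  qed
  show ?thesis
    using spectral_traceability_oriented[OF XY n0 assms(3,4)] unfolding tr by blast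
qed

end
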